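(* Let $a \in L^\infty(\Omega)$ be such that $a(x) \ge \lambda_1^L$ for a.e. $x\in\Omega$ and $|\{x \in \Omega : a(x) > \lambda_1^L\}| > 0$. Let $v$ be a nontrivial (weak) solution of $$L_\Delta v = a(x) v \ \text{ in } \Omega, \qquad v = 0 \ \text{ in } \mathbb{R}^N\setminus\Omega .$$ Then $v$ is a sign-changing function in $\Omega$.
   Context: Let $N\ge 1$ be an integer and let $\Omega\subset\mathbb{R}^N$ be a bounded domain (open and connected) with $C^{1,1}$ boundary. $|A|$ denotes Lebesgue measure and $\|\cdot\|_2$ is the $L^2(\Omega)$ norm. Put $c_N=\pi^{-N/2}\Gamma(N/2)$ and $\rho_N=2\ln 2+\psi(N/2)-\gamma$, with $\psi=\Gamma'/\Gamma$ the digamma function and $\gamma=-\Gamma'(1)$; $B_1$ is the unit ball centred at $0$, $k(z)=\mathbf 1_{B_1}(z)|z|^{-N}$, $j(z)=\mathbf 1_{\mathbb{R}^N\setminus B_1}(z)|z|^{-N}$ for $z\neq 0$. $\mathbb{H}(\Omega)$ is the Hilbert space of all $u\in L^2(\Omega)$, extended by $u=0$ in $\mathbb{R}^N\setminus\Omega$, with $\iint_{\mathbb{R}^{2N}}|u(x)-u(y)|^2k(x-y)\,dx\,dy<\infty$, with inner product $\mathcal{E}(u,v)=\frac{c_N}{2}\iint_{\mathbb{R}^{2N}}(u(x)-u(y))(v(x)-v(y))k(x-y)\,dx\,dy$. The quadratic form of the logarithmic Laplacian $L_\Delta$ (the operator with Fourier symbol $2\ln|\xi|$) is $$\mathcal{E}_L(u,v)=\mathcal{E}(u,v)-c_N\iint_{\mathbb{R}^{2N}}u(x)v(y)j(x-y)\,dx\,dy+\rho_N\int_{\mathbb{R}^N}uv\,dx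 .$$ A (weak) solution of $L_\Delta v=a(x)v$ in $\Omega$, $v=0$ in $\mathbb{R}^N\setminus\Omega$, is a $v\in\mathbb{H}(\Omega)$ with $\mathcal{E}_L(v,\phi)=\int_\Omega a v\phi\,dx$ for all $\phi\in\mathbb{H}(\Omega)$. The first eigenvalue is $\lambda_1^L=\min\{\mathcal{E}_L(u,u):u\in\mathbb{H}(\Omega),\ \|u\|_2=1\}$ (it may be negative). A function $v$ is sign-changing in $\Omega$ if both $\{x\in\Omega:v(x)>0\}$ and $\{x\in\Omega:v(x)<0\}$ have positive measure. *)

theory Defs
  imports "HOL-Analysis.Analysis"
begin

section \<open>Domains with a $C^{1,1}$ boundary\<close>

text \<open>The space $R^N$ is an arbitrary Euclidean space \<^typ>\<open>'a\<close> with \<open>N = DIM('a)\<close>.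

  A function is of class $C^{1,1}$ if it is differentiable with Lipschitz continuous gradient.\<close>

definition C11_function :: "('a::euclidean_space \<Rightarrow> real) \<Rightarrow> bool" where
  "C11_function g \<longleftrightarrow>
     (\<exists>G :: 'a \<Rightarrow> 'a. \<exists>L. (\<forall>x. (g has_derivative (\<lambda>h. G x \<bullet> h)) (at x)) \<and> L-lipschitz_on UNIV G)"

text \<open>Near each boundary point \<open>\<Omega>\<close> is the region above a $C^{1,1}$ graph in the direction of a
  unit vector \<open>e\<close>. The function \<open>g\<close> is evaluated only at the orthogonal projection
  \<open>x - (x \<bullet> e) *\<^sub>R e\<close> onto the hyperplane orthogonal to \<open>e\<close>; a $C^{1,1}$ function on that hyperplane
  extends to the whole space by composition with the projection, so nothing is lost by taking
  \<open>g\<close> on \<^typ>\<open>'a\<close>. For \<open>N = 1\<close> the hyperplane is a point and \<open>g\<close> is a constant.\<close>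

definition C11_boundary :: "'a::euclidean_space set \<Rightarrow> bool" where
  "C11_boundary \<Omega> \<longleftrightarrow>
     (\<forall>p \<in> frontier \<Omega>. \<exists>r>0. \<exists>e g. norm e = 1 \<and> C11_function g \<and>
        \<Omega> \<inter> ball p r = {x \<in> ball p r. x \<bullet> e > g (x - (x \<bullet> e) *\<^sub>R e)})"

definition bounded_C11_domain :: "'a::euclidean_space set \<Rightarrow> bool" where
  "bounded_C11_domain \<Omega> \<longleftrightarrow>
     open \<Omega> \<and> connected \<Omega> \<and> \<Omega> \<noteq> {} \<and> bounded \<Omega> \<and> C11_boundary \<Omega>"


section \<open>The logarithmic Laplacian\<close>

text \<open>Constants depending on the dimension; \<^const>\<open>Digamma\<close> is $\Gamma'/\Gamma$ and
  \<^const>\<open>euler_mascheroni\<close> is $-\Gamma'(1)$.\<close>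

definition c_const :: "nat \<Rightarrow> real" where
  "c_const N = pi powr (- (real N / 2)) * Gamma (real N / 2)"

definition rho_const :: "nat \<Rightarrow> real" where
  "rho_const N = 2 * ln 2 + Digamma (real N / 2) - euler_mascheroni"

text \<open>At \<open>z = 0\<close> the kernel \<open>k\<close> takes the irrelevant value \<open>0\<close>, because \<open>1 / 0 = 0\<close>.\<close>

definition k_kernel :: "'a::euclidean_space \<Rightarrow> real" where
  "k_kernel z = indicator (ball 0 1) z / norm z ^ DIM('a)"

definition j_kernel :: "'a::euclidean_space \<Rightarrow> real" where
  "j_kernel z = indicator (- ball 0 1) z / norm z ^ DIM('a)"

text \<open>Elements of $L^2(\Omega)$ and of $H(\Omega)$ are represented by Lebesgue measurable functions on
  the whole space that vanish outside \<open>\<Omega>\<close>; functions that agree almost everywhere are not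
  identified.\<close>

definition H_space :: "'a::euclidean_space set \<Rightarrow> ('a \<Rightarrow> real) set" where
  "H_space \<Omega> =
     {u. u \<in> borel_measurable lebesgue \<and> integrable lebesgue (\<lambda>x. (u x)\<^sup>2) \<and>
         (\<forall>x. x \<notin> \<Omega> \<longrightarrow> u x = 0) \<and>
         integrable (lebesgue \<Otimes>\<^sub>M lebesgue) (\<lambda>(x, y). (u x - u y)\<^sup>2 * k_kernel (x - y))}"

definition E_form :: "('a::euclidean_space \<Rightarrow> real) \<Rightarrow> ('a \<Rightarrow> real) \<Rightarrow> real" where
  "E_form u v = c_const DIM('a) / 2 *
     (LINT (x, y) | (lebesgue \<Otimes>\<^sub>M lebesgue). (u x - u y) * (v x - v y) * k_kernel (x - y))"

definition EL_form :: "('a::euclidean_space \<Rightarrow> real) \<Rightarrow> ('a \<Rightarrow> real) \<Rightarrow> real" where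
  "EL_form u v = E_form u v
     - c_const DIM('a) * (LINT (x, y) | (lebesgue \<Otimes>\<^sub>M lebesgue). u x * v y * j_kernel (x - y))
     + rho_const DIM('a) * (LINT x | lebesgue. u x * v x)"

text \<open>The first eigenvalue is the minimum of \<open>EL_form u u\<close> over the $L^2$ unit sphere of
  \<open>H_space \<Omega>\<close>, written as an infimum, which is the minimum whenever the latter is attained.\<close>

definition first_eigenvalue :: "'a::euclidean_space set \<Rightarrow> real" where
  "first_eigenvalue \<Omega> =
     Inf {EL_form u u | u. u \<in> H_space \<Omega> \<and> sqrt (LINT x | lebesgue_on \<Omega>. (u x)\<^sup>2) = 1}"

definition Linfty :: "'a::euclidean_space set \<Rightarrow> ('a \<Rightarrow> real) set" where
  "Linfty \<Omega> =
     {a. a \<in> borel_measurable (lebesgue_on \<Omega>) \<and> (\<exists>C. AE x in lebesgue_on \<Omega>. \<bar>a x\<bar> \<le> C)}"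

text \<open>Weak solutions of $L_\Delta v = a(x) v$ in \<open>\<Omega>\<close>, $v = 0$ outside \<open>\<Omega>\<close>.\<close>

definition weak_solution ::
    "'a::euclidean_space set \<Rightarrow> ('a \<Rightarrow> real) \<Rightarrow> ('a \<Rightarrow> real) \<Rightarrow> bool" where
  "weak_solution \<Omega> a v \<longleftrightarrow> v \<in> H_space \<Omega> \<and>
     (\<forall>\<phi> \<in> H_space \<Omega>. EL_form v \<phi> = (LINT x | lebesgue_on \<Omega>. a x * v x * \<phi> x))"

definition sign_changing :: "'a::euclidean_space set \<Rightarrow> ('a \<Rightarrow> real) \<Rightarrow> bool" where
  "sign_changing \<Omega> v \<longleftrightarrow>
     emeasure lebesgue {x \<in> \<Omega>. v x > 0} > 0 \<and> emeasure lebesgue {x \<in> \<Omega>. v x < 0} > 0"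

end

theory Submission
  imports Defs
begin

text \<open>
  Suppose that \<open>v\<close> does not change sign; replacing it by \<open>\<bar>v\<bar>\<close> it may be taken nonnegative. The classical
  argument tests the equation with a positive first eigenfunction $\varphi_1$ and obtains
  $\int (a-\lambda_1)v\varphi_1 = 0$, which is impossible if both factors are positive. The argument below
  exchanges the roles: the solution \<open>v\<close> serves as the positive comparison function and is tested
  against almost minimizers of the quadratic form, which take the place of the eigenfunction.

  The main tool is a Picone inequality (\<open>picone_inequality\<close>). For bounded \<open>u\<close> in the energy space and $d>0$ put
  $w = u/(v+d)$ and test the equation with $u^2/(v+d)$. This gives
  \[ \frac{c_N}{2}\iint_{\Omega\times\Omega} (v(x)+d)(v(y)+d)(w(x)-w(y))^2\,|x-y|^{-N}\,dx\,dy
     \leq \mathcal{E}_L(u,u) - \int a u^2 + C\int \frac{d}{v+d}\,u^2 \]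
  with \<open>C\<close> independent of \<open>u\<close> and \<open>d\<close>. It is used twice.

  First, for \<open>u\<close> the distance to the complement of \<open>\<Omega>\<close>, the left-hand side would blow up as \<open>d\<close> tends to zero if
  both $\{v>0\}$ and $\{v=0\}$ had positive measure in \<open>\<Omega>\<close>. Hence \<open>v\<close> is positive almost everywhere in \<open>\<Omega>\<close>
  (\<open>strong_maximum_principle\<close>), and therefore the last integral tends to zero with \<open>d\<close>.

  Secondly, for bounded almost minimizers $u_n$ of the Rayleigh quotient of $\mathcal{E}_L$, with
  $1/2\leq\|u_n\|_2^2\leq 1$, and sufficiently small $d_n$, the inequality forces both $\int (a-\lambda_1)u_n^2$ and the double integral to tend to zero. The former shows that
  $u_n\to 0$ where $a>\lambda_1$. The latter shows that the quotients $u_n(x)/(v(x)+d_n)$ become independent of the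
  point, so that $u_n\to 0$ almost everywhere (\<open>no_nonnegative_solution\<close>).

  This contradicts the nonintegrability of the kernel at the origin. Cutting the kernel off near the origin
  leaves a bounded kernel of arbitrarily large mass \<open>m\<close>, and
  $\mathcal{E}(u,u) \geq c_N (m\|u\|_2^2 - K_m\|u\|_1^2)$ (\<open>dyadic_coercivity\<close>). The energies of the $u_n$ are bounded,
  their $L^2$ norms are bounded below, and almost everywhere convergence together with the $L^2$ bound gives
  $\|u_n\|_1\to 0$; for large \<open>m\<close> this is impossible (\<open>no_vanishing_almost_minimizers\<close>).
\<close>

section \<open>Null sets and integrals on the product space\<close>

lemma sigma_finite_lebesgue: "sigma_finite_measure (lebesgue :: 'a::euclidean_space measure)"
proof
  obtain A :: "'a set set" where A: "countable A" "A \<subseteq> sets lborel" "\<Union>A = space lborel"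
    "\<forall>a\<in>A. emeasure lborel a \<noteq> \<infinity>"
    using sigma_finite_measure.sigma_finite_countable[OF sigma_finite_lborel] by blast
  show "\<exists>A. countable A \<and> A \<subseteq> sets lebesgue \<and> \<Union>A = space lebesgue \<and>
      (\<forall>a\<in>A. emeasure (lebesgue :: 'a measure) a \<noteq> \<infinity>)"
    using A by (intro exI[of _ A]) (auto simp: subset_iff emeasure_completion)
qed

interpretation leb: sigma_finite_measure "lebesgue :: 'a::euclidean_space measure"
  by (rule sigma_finite_lebesgue)

interpretation leb_pair: pair_sigma_finite "lebesgue :: 'a::euclidean_space measure"
  "lebesgue :: 'b::euclidean_space measure" ..

abbreviation leb2 :: "('a::euclidean_space \<times> 'a) measure" where
  "leb2 \<equiv> lebesgue \<Otimes>\<^sub>M lebesgue"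

lemma AE_leb2_coordinates:
  fixes P :: "'a::euclidean_space \<Rightarrow> bool"
  assumes "AE x in lebesgue. P x"
  shows "AE p in leb2. P (fst p) \<and> P (snd p)"
proof -
  obtain N where N: "N \<in> null_sets lebesgue" "{x. \<not> P x} \<subseteq> N"
    using assms by (auto simp: eventually_ae_filter)
  have "N \<times> UNIV \<in> null_sets (leb2 :: ('a \<times> 'a) measure)" "UNIV \<times> N \<in> null_sets (leb2 :: ('a \<times> 'a) measure)"
    using N(1) by (auto simp: null_sets_def leb.emeasure_pair_measure_Times intro!: pair_measureI)
  then have "AE p in (leb2 :: ('a \<times> 'a) measure). p \<notin> N \<times> UNIV" "AE p in (leb2 :: ('a \<times> 'a) measure). p \<notin> UNIV \<times> N"
    by (auto intro: AE_not_in)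
  then show ?thesis
    by eventually_elim (use N(2) in auto)
qed

lemma integrable_leb2_times:
  fixes f g :: "'a::euclidean_space \<Rightarrow> real"
  assumes f: "integrable lebesgue f" and g: "integrable lebesgue g"
  shows "integrable leb2 (\<lambda>(x, y). f x * g y)"
    and "(LINT (x, y)|leb2. f x * g y) = (LINT x|lebesgue. f x) * (LINT y|lebesgue. g y)"
proof -
  have [measurable]: "f \<in> borel_measurable lebesgue" "g \<in> borel_measurable lebesgue"
    using f g by auto
  show *: "integrable leb2 (\<lambda>(x, y). f x * g y)"
    by (rule leb_pair.Fubini_integrable) (use f g in \<open>auto simp: split_beta' abs_mult\<close>)
  show "(LINT (x, y)|leb2. f x * g y) = (LINT x|lebesgue. f x) * (LINT y|lebesgue. g y)"
    using leb_pair.integral_fst'[OF *] by simp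
qed

text \<open>Summability of the integrals makes the series of the functions finite almost everywhere, so its terms
  tend to zero. Geometric bounds thus give convergence along the whole sequence.\<close>

lemma AE_LIMSEQ_zero_of_geometric:
  fixes f :: "nat \<Rightarrow> 'b \<Rightarrow> real"
  assumes int: "\<And>n. integrable M (f n)" and nonneg: "\<And>n. AE x in M. 0 \<le> f n x"
    and le: "\<And>n. (LINT x|M. f n x) \<le> C * (1/2)^n"
  shows "AE x in M. (\<lambda>n. f n x) \<longlonglongrightarrow> 0"
proof -
  have [measurable]: "f n \<in> borel_measurable M" for n using int by auto
  have C: "0 \<le> C"
    using integral_nonneg_AE[OF nonneg[of 0]] le[of 0] by simp
  have "(\<integral>\<^sup>+x. (\<Sum>n. ennreal (f n x)) \<partial>M) = (\<Sum>n. \<integral>\<^sup>+x. ennreal (f n x) \<partial>M)"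
    by (intro nn_integral_suminf) auto
  also have "\<dots> \<le> (\<Sum>n. ennreal (C * (1/2)^n))"
    using int nonneg le by (intro suminf_le) (auto simp: nn_integral_eq_integral intro!: ennreal_leI)
  also have "\<dots> < \<infinity>"
    using C by (subst suminf_ennreal2) (auto intro!: summable_mult summable_geometric)
  finally have "AE x in M. (\<Sum>n. ennreal (f n x)) \<noteq> \<infinity>"
    by (intro nn_integral_PInf_AE) auto
  moreover have "AE x in M. \<forall>n. 0 \<le> f n x"
    using nonneg by (simp add: AE_all_countable)
  ultimately show ?thesis
  proof eventually_elim
    case (elim x)
    then have "summable (\<lambda>n. f n x)"
      by (intro summable_suminf_not_top) auto
    then show ?case by (rule summable_LIMSEQ_zero)
  qed
qed

section \<open>The kernels and dyadic shells\<close>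

lemma k_kernel_nonneg: "0 \<le> k_kernel z" and j_kernel_nonneg: "0 \<le> j_kernel z"
  by (auto simp: k_kernel_def j_kernel_def)

lemma k_kernel_commute: "k_kernel (x - y) = k_kernel (y - x)"
  and j_kernel_commute: "j_kernel (x - y) = j_kernel (y - x)"
  by (simp_all add: k_kernel_def j_kernel_def norm_minus_commute indicator_def)

lemma j_kernel_le_1: "j_kernel z \<le> 1"
  by (auto simp: j_kernel_def indicator_def divide_le_eq)

lemma kernels_pos: "z \<noteq> 0 \<Longrightarrow> 0 < k_kernel z + j_kernel z"
  by (auto simp: k_kernel_def j_kernel_def indicator_def)

lemma measurable_diff_leb2 [measurable]:
  "(\<lambda>p. fst p - snd p) \<in> leb2 \<rightarrow>\<^sub>M (borel :: 'a::euclidean_space measure)"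
proof -
  have "(\<lambda>x::'a. x) \<in> lebesgue \<rightarrow>\<^sub>M borel"
    by (simp add: measurable_completion)
  from measurable_compose[OF measurable_fst this] measurable_compose[OF measurable_snd this]
  show ?thesis by (intro borel_measurable_diff)
qed

lemma borel_measurable_k_kernel [measurable]:
    "(k_kernel :: 'a::euclidean_space \<Rightarrow> real) \<in> borel_measurable borel"
  and borel_measurable_j_kernel [measurable]:
    "(j_kernel :: 'a::euclidean_space \<Rightarrow> real) \<in> borel_measurable borel"
  unfolding k_kernel_def[abs_def] j_kernel_def[abs_def]
  by (intro borel_measurable_divide borel_measurable_indicator borel_measurable_power
      borel_measurable_norm; simp)+

text \<open>The shells partition the punctured unit ball. On the shell of index \<open>i\<close> the singular kernel is
  comparable to its value \<open>2 ^ (i * N)\<close>, while the measure of the shell is proportional to the inverse of that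
  value. Estimates on shells therefore reduce to the volumes of balls.\<close>

definition shell :: "nat \<Rightarrow> 'a::euclidean_space set" where
  "shell i = {z. (1/2)^Suc i \<le> norm z \<and> norm z < (1/2)^i}"

lemma shell_sets [measurable]: "shell i \<in> sets borel"
  unfolding shell_def by measurable

lemma exists_shell:
  fixes z :: "'a::euclidean_space"
  assumes "z \<noteq> 0" "norm z < 1"
  shows "\<exists>i. z \<in> shell i"
proof -
  define i where "i = (LEAST i. (1/2)^Suc i \<le> norm z)"
  obtain n where "(1/2)^n < norm z"
    using real_arch_pow_inv[of "norm z" "1/2"] assms by auto
  moreover have "(1/2::real)^Suc n \<le> (1/2)^n" by simp
  ultimately have "(1/2)^Suc n \<le> norm z" by linarith
  then have i: "(1/2)^Suc i \<le> norm z"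
    unfolding i_def by (rule LeastI)
  have "norm z < (1/2)^i"
  proof (cases i)
    case (Suc j)
    then have "\<not> (1/2)^Suc j \<le> norm z"
      unfolding i_def by (intro not_less_Least) simp
    with Suc show ?thesis by simp
  qed (use assms in simp)
  with i show ?thesis by (auto simp: shell_def)
qed

lemma sum_indicator_shell:
  "(\<Sum>i<n. indicator (shell i) z) = (indicator {z. (1/2)^n \<le> norm z \<and> norm z < 1} z :: real)"
proof (induction n)
  case (Suc n)
  have "(1/2::real)^Suc n \<le> (1/2)^n" "(1/2::real)^n \<le> 1"
    by (auto simp: power_le_one)
  then have "(indicator (shell n) z :: real) + indicator {z. (1/2)^n \<le> norm z \<and> norm z < 1} z
    = indicator {z. (1/2)^Suc n \<le> norm z \<and> norm z < 1} z"
    using order_trans[OF \<open>(1/2::real)^Suc n \<le> (1/2)^n\<close>, of "norm z"]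
    unfolding shell_def indicator_def by (auto simp del: power_Suc)
  with Suc show ?case by simp
qed (simp add: indicator_def)

lemma measure_shell:
  fixes x :: "'a::euclidean_space"
  shows "measure lebesgue {y. x - y \<in> shell i} =
    unit_ball_vol DIM('a) * (1 - (1/2)^DIM('a)) * ((1/2)^i)^DIM('a)"
    and "{y. x - y \<in> shell i} \<in> lmeasurable"
proof -
  have *: "{y. x - y \<in> shell i} = ball x ((1/2)^i) - ball x ((1/2)^Suc i)"
    by (auto simp: shell_def dist_norm)
  have sub: "ball x ((1/2)^Suc i) \<subseteq> ball x ((1/2)^i)" by (intro subset_ball) simp
  show "{y. x - y \<in> shell i} \<in> lmeasurable"
    unfolding * by (intro fmeasurable_Diff lmeasurable_ball) auto
  have "measure lebesgue {y. x - y \<in> shell i}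
      = measure lebesgue (ball x ((1/2)^i)) - measure lebesgue (ball x ((1/2)^Suc i))"
    unfolding * by (intro measurable_measure_Diff sub) auto
  also have "\<dots> = unit_ball_vol DIM('a) * ((1/2)^i)^DIM('a) - unit_ball_vol DIM('a) * ((1/2)^Suc i)^DIM('a)"
    by (simp add: content_ball del: power_Suc)
  also have "\<dots> = unit_ball_vol DIM('a) * (1 - (1/2)^DIM('a)) * ((1/2)^i)^DIM('a)"
    by (simp add: power_mult_distrib algebra_simps power_divide)
  finally show "measure lebesgue {y. x - y \<in> shell i} =
    unit_ball_vol DIM('a) * (1 - (1/2)^DIM('a)) * ((1/2)^i)^DIM('a)" .
qed

text \<open>A bounded step minorant of the singular kernel. Each shell carries the same mass, so its integral
  grows linearly in \<open>n\<close> and is unbounded: this expresses that \<open>k_kernel\<close> is not integrable.\<close>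

definition dyadic_kernel :: "nat \<Rightarrow> 'a::euclidean_space \<Rightarrow> real" where
  "dyadic_kernel n z = (\<Sum>i<n. 2 ^ (i * DIM('a)) * indicator (shell i) z)"

lemma borel_measurable_dyadic_kernel [measurable]:
  "(dyadic_kernel n :: 'a::euclidean_space \<Rightarrow> real) \<in> borel_measurable borel"
  unfolding dyadic_kernel_def[abs_def] by measurable

lemma dyadic_kernel_nonneg: "0 \<le> dyadic_kernel n z"
  unfolding dyadic_kernel_def by (intro sum_nonneg) auto

lemma dyadic_kernel_commute: "dyadic_kernel n (x - y) = dyadic_kernel n (y - x)"
  by (simp add: dyadic_kernel_def shell_def indicator_def norm_minus_commute)

lemma dyadic_kernel_le_k_kernel: "dyadic_kernel n z \<le> k_kernel z"
proof -
  have "2 ^ (i * DIM('a)) * indicator (shell i) z \<le> k_kernel z * indicator (shell i) z" for i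
  proof (cases "z \<in> shell i")
    case True
    have "(1/2::real)^Suc i > 0" by simp
    with True have z: "0 < norm z" "norm z < (1/2)^i"
      unfolding shell_def mem_Collect_eq by (blast intro: less_le_trans)+
    moreover have "(1/2::real)^i \<le> 1" by (simp add: power_le_one)
    ultimately have "norm z < 1" by linarith
    have "norm z ^ DIM('a) \<le> ((1/2)^i) ^ DIM('a)"
      using z by (intro power_mono) auto
    then have "2 ^ (i * DIM('a)) * norm z ^ DIM('a) \<le> 2 ^ (i * DIM('a)) * ((1/2)^i) ^ DIM('a)"
      by simp
    also have "\<dots> = 1"
      by (simp add: power_mult power_mult_distrib [symmetric])
    finally show ?thesis
      using z \<open>norm z < 1\<close> True by (simp add: k_kernel_def field_simps)
  qed simp
  then have "dyadic_kernel n z \<le> k_kernel z * (\<Sum>i<n. indicator (shell i) z)"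
    unfolding dyadic_kernel_def by (simp only: sum_distrib_left) (rule sum_mono)
  also have "\<dots> \<le> k_kernel z * 1"
    unfolding sum_indicator_shell by (intro mult_left_mono k_kernel_nonneg) (simp add: indicator_def)
  finally show ?thesis by simp
qed

lemma dyadic_kernel_le:
  fixes z :: "'a::euclidean_space"
  shows "dyadic_kernel n z \<le> 2 ^ (n * DIM('a))"
proof -
  have "dyadic_kernel n z \<le> (\<Sum>i<n. 2 ^ (n * DIM('a)) * indicator (shell i) z)"
    unfolding dyadic_kernel_def
    by (intro sum_mono mult_right_mono power_increasing) auto
  also have "\<dots> = 2 ^ (n * DIM('a)) * (\<Sum>i<n. indicator (shell i) z)"
    by (simp add: sum_distrib_left)
  also have "\<dots> \<le> 2 ^ (n * DIM('a)) * 1"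
    unfolding sum_indicator_shell by (intro mult_left_mono) (auto simp: indicator_def)
  finally show ?thesis by simp
qed

text \<open>The integral of \<open>2 ^ (i * N)\<close> over the shell of index \<open>i\<close>, which is the same for all \<open>i\<close>.\<close>

definition shell_mass :: "nat \<Rightarrow> real" where
  "shell_mass N = unit_ball_vol N * (1 - (1/2)^N)"

lemma shell_mass_pos: "0 < shell_mass DIM('a::euclidean_space)"
  unfolding shell_mass_def
  by (intro mult_pos_pos) (auto simp: power_less_one_iff)

lemma dyadic_kernel_integral:
  fixes x :: "'a::euclidean_space"
  shows "integrable lebesgue (\<lambda>y. dyadic_kernel n (x - y))"
    and "(LINT y|lebesgue. dyadic_kernel n (x - y)) = n * shell_mass DIM('a)"
proof -
  have *: "dyadic_kernel n (x - y)
      = (\<Sum>i<n. 2 ^ (i * DIM('a)) * indicator {y. x - y \<in> shell i} y)" for y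
    by (simp add: dyadic_kernel_def indicator_def)
  have i: "integrable lebesgue (\<lambda>y. 2 ^ (i * DIM('a)) * indicator {y. x - y \<in> shell i} y :: real)" for i
    using measure_shell(2)[of x i] by (auto simp: fmeasurable_def)
  then show "integrable lebesgue (\<lambda>y. dyadic_kernel n (x - y))"
    unfolding * by (rule Bochner_Integration.integrable_sum)
  have "(LINT y|lebesgue. dyadic_kernel n (x - y))
    = (\<Sum>i<n. 2 ^ (i * DIM('a)) * measure lebesgue {y. x - y \<in> shell i})"
    unfolding * by (subst Bochner_Integration.integral_sum[OF i]) simp
  also have "\<dots> = (\<Sum>i<n. shell_mass DIM('a))"
    by (intro sum.cong) (simp_all add: measure_shell shell_mass_def power_mult power_mult_distrib[symmetric])
  finally show "(LINT y|lebesgue. dyadic_kernel n (x - y)) = n * shell_mass DIM('a)"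
    by simp
qed

section \<open>A coercivity estimate replacing compactness\<close>

text \<open>Expanding the square in the energy of the bounded minorant gives twice its total mass times
  $\|u\|_2^2$ minus a cross term, which a bounded kernel controls by $\|u\|_1^2$. Since the mass is unbounded in
  \<open>n\<close>, a set of functions with bounded energy cannot keep its $L^2$ norm while its $L^1$ norm tends to zero.
  This is the only form of compactness that the proof uses.\<close>

lemma dyadic_coercivity:
  fixes u :: "'a::euclidean_space \<Rightarrow> real"
  assumes u: "integrable lebesgue u" and u2: "integrable lebesgue (\<lambda>x. (u x)\<^sup>2)"
    and k: "integrable leb2 (\<lambda>(x, y). (u x - u y)\<^sup>2 * k_kernel (x - y))"
  shows "n * shell_mass DIM('a) * (LINT x|lebesgue. (u x)\<^sup>2)
     - 2 ^ (n * DIM('a)) * (LINT x|lebesgue. \<bar>u x\<bar>)\<^sup>2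
     \<le> 1 / 2 * (LINT (x, y)|leb2. (u x - u y)\<^sup>2 * k_kernel (x - y))"
proof -
  have [measurable]: "u \<in> borel_measurable lebesgue" using u by auto
  let ?D = "dyadic_kernel n :: 'a \<Rightarrow> real" and ?K = "2 ^ (n * DIM('a)) :: real"
  define f where "f = (\<lambda>(x, y). (u x)\<^sup>2 * ?D (x - y))"
  have [measurable]: "f \<in> borel_measurable leb2" unfolding f_def split_beta' by measurable
  have f: "integrable leb2 f"
    by (rule leb_pair.Fubini_integrable)
      (use u2 in \<open>auto simp: f_def dyadic_kernel_nonneg abs_mult dyadic_kernel_integral\<close>)
  have f_int: "(LINT p|leb2. f p) = n * shell_mass DIM('a) * (LINT x|lebesgue. (u x)\<^sup>2)"
    using leb_pair.integral_fst'[OF f, symmetric]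
    by (simp add: f_def dyadic_kernel_integral del: leb_pair.integral_fst')
  have f': "integrable leb2 (\<lambda>(x, y). f (y, x))"
    using leb_pair.integrable_product_swap[OF f] by simp
  have f'_int: "(LINT (x, y)|leb2. f (y, x)) = (LINT p|leb2. f p)"
    using leb_pair.integral_product_swap[of f] by simp
  have g: "integrable leb2 (\<lambda>(x, y). \<bar>u x\<bar> * \<bar>u y\<bar>)"
    "(LINT (x, y)|leb2. \<bar>u x\<bar> * \<bar>u y\<bar>) = (LINT x|lebesgue. \<bar>u x\<bar>)\<^sup>2"
    using u by (simp_all add: integrable_leb2_times power2_eq_square)
  have "(LINT p|leb2. f p + f (snd p, fst p) - 2 * ?K * (\<bar>u (fst p)\<bar> * \<bar>u (snd p)\<bar>))
     \<le> (LINT p|leb2. (u (fst p) - u (snd p))\<^sup>2 * k_kernel (fst p - snd p))"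
  proof (rule integral_mono)
    fix p :: "'a \<times> 'a"
    obtain x y where p: "p = (x, y)" by (cases p)
    have "u x * u y * ?D (x - y) \<le> \<bar>u x\<bar> * \<bar>u y\<bar> * ?K"
      using dyadic_kernel_le[of n "x - y"] dyadic_kernel_nonneg[of n "x - y"]
      by (intro mult_mono[of "u x * u y"]) (auto simp: order_trans[OF abs_ge_self eq_refl[OF abs_mult]])
    then have "(u x)\<^sup>2 * ?D (x - y) + (u y)\<^sup>2 * ?D (y - x) - 2 * ?K * (\<bar>u x\<bar> * \<bar>u y\<bar>)
        \<le> (u x - u y)\<^sup>2 * ?D (x - y)"
      unfolding dyadic_kernel_commute[of n y x] power2_diff by (simp add: algebra_simps)
    also have "\<dots> \<le> (u x - u y)\<^sup>2 * k_kernel (x - y)"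
      by (intro mult_left_mono dyadic_kernel_le_k_kernel) simp
    finally show "f p + f (snd p, fst p) - 2 * ?K * (\<bar>u (fst p)\<bar> * \<bar>u (snd p)\<bar>)
        \<le> (u (fst p) - u (snd p))\<^sup>2 * k_kernel (fst p - snd p)"
      by (simp add: f_def p)
  qed (use f f' g k in \<open>auto simp: split_beta'\<close>)
  also have "(LINT p|leb2. f p + f (snd p, fst p) - 2 * ?K * (\<bar>u (fst p)\<bar> * \<bar>u (snd p)\<bar>))
    = 2 * (n * shell_mass DIM('a) * (LINT x|lebesgue. (u x)\<^sup>2)) - 2 * ?K * (LINT x|lebesgue. \<bar>u x\<bar>)\<^sup>2"
    using f f' g f_int f'_int by (simp add: split_beta')
  finally show ?thesis by (simp add: split_beta')
qed

section \<open>Lipschitz functions have finite energy\<close>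

text \<open>On the shell of index \<open>i\<close> the factor $|z|^2$ contributes $4^{-i}$ and the kernel contributes a
  constant mass, so that the second moment is dominated by a geometric series, uniformly in the centre.\<close>

lemma nn_integral_second_moment_le:
  fixes x :: "'a::euclidean_space"
  shows "(\<integral>\<^sup>+y. ennreal ((norm (x - y))\<^sup>2 * k_kernel (x - y)) \<partial>lebesgue)
     \<le> (\<Sum>i. ennreal (2 ^ DIM('a) * shell_mass DIM('a) * (1/4)^i))"
proof -
  have "ennreal ((norm z)\<^sup>2 * k_kernel z)
     \<le> (\<Sum>i. ennreal ((1/4)^i * 2 ^ (Suc i * DIM('a)) * indicator (shell i) z))" for z :: 'a
  proof (cases "z \<noteq> 0 \<and> norm z < 1")
    case True
    then obtain i where i: "z \<in> shell i" using exists_shell by blast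
    then have lo: "(1/2)^Suc i \<le> norm z" and hi: "norm z \<le> (1/2)^i" by (auto simp: shell_def)
    have "(norm z)\<^sup>2 \<le> ((1/2)^i)\<^sup>2" using hi by (intro power_mono) auto
    also have "((1/2::real)^i)\<^sup>2 = (1/4)^i"
      by (simp add: power2_eq_square flip: power_mult_distrib)
    finally have 1: "(norm z)\<^sup>2 \<le> (1/4)^i" .
    have "((1/2)^Suc i)^DIM('a) \<le> norm z ^ DIM('a)" using lo by (intro power_mono) auto
    then have "2 ^ (Suc i * DIM('a)) * ((1/2)^Suc i)^DIM('a) \<le> 2 ^ (Suc i * DIM('a)) * norm z ^ DIM('a)"
      by (rule mult_left_mono) simp
    moreover have "2 ^ (Suc i * DIM('a)) * ((1/2::real)^Suc i)^DIM('a) = 1"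
      unfolding power_mult by (simp flip: power_mult_distrib del: power_Suc)
    ultimately have 2: "k_kernel z \<le> 2 ^ (Suc i * DIM('a))"
      using True by (simp add: k_kernel_def field_simps)
    have "ennreal ((norm z)\<^sup>2 * k_kernel z)
      \<le> ennreal ((1/4)^i * 2 ^ (Suc i * DIM('a)) * indicator (shell i) z)"
      using i 1 2 by (intro ennreal_leI) (auto intro!: mult_mono simp: k_kernel_nonneg)
    also have "\<dots> = (\<Sum>i\<in>{i}. ennreal ((1/4)^i * 2 ^ (Suc i * DIM('a)) * indicator (shell i) z))"
      by (simp only: sum.insert sum.empty finite.emptyI empty_iff not_False_eq_True add_0_right)
    also have "\<dots> \<le> (\<Sum>i. ennreal ((1/4)^i * 2 ^ (Suc i * DIM('a)) * indicator (shell i) z))"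
      by (intro sum_le_suminf) auto
    finally show ?thesis .
  qed (auto simp: k_kernel_def)
  then have "(\<integral>\<^sup>+y. ennreal ((norm (x - y))\<^sup>2 * k_kernel (x - y)) \<partial>lebesgue)
    \<le> (\<integral>\<^sup>+y. (\<Sum>i. ennreal ((1/4)^i * 2 ^ (Suc i * DIM('a)) * indicator (shell i) (x - y))) \<partial>lebesgue)"
    by (intro nn_integral_mono)
  also have "\<dots> = (\<integral>\<^sup>+y. (\<Sum>i. ennreal ((1/4)^i * 2 ^ (Suc i * DIM('a)))
        * indicator {y. x - y \<in> shell i} y) \<partial>lebesgue)"
    by (intro nn_integral_cong suminf_cong) (auto simp: indicator_def)
  also have "\<dots> = (\<Sum>i. ennreal ((1/4)^i * 2 ^ (Suc i * DIM('a)))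
        * emeasure lebesgue {y. x - y \<in> shell i})"
  proof (subst nn_integral_suminf)
    have sets: "{y. x - y \<in> shell i} \<in> sets lebesgue" for i
      using measure_shell(2)[of x i] by auto
    show "(\<lambda>y. ennreal ((1/4)^i * 2 ^ (Suc i * DIM('a))) * indicator {y. x - y \<in> shell i} y)
        \<in> borel_measurable lebesgue" for i
      by (intro borel_measurable_times_ennreal borel_measurable_const borel_measurable_indicator sets)
    show "(\<Sum>i. \<integral>\<^sup>+y. ennreal ((1/4)^i * 2 ^ (Suc i * DIM('a))) * indicator {y. x - y \<in> shell i} y \<partial>lebesgue)
      = (\<Sum>i. ennreal ((1/4)^i * 2 ^ (Suc i * DIM('a))) * emeasure lebesgue {y. x - y \<in> shell i})"
      by (intro suminf_cong nn_integral_cmult_indicator sets)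
  qed
  also have "\<dots> = (\<Sum>i. ennreal (2 ^ DIM('a) * shell_mass DIM('a) * (1/4)^i))"
  proof (intro suminf_cong)
    fix i
    have "2 ^ (i * DIM('a)) * ((1/2::real)^i)^DIM('a) = 1"
      by (simp add: power_mult flip: power_mult_distrib)
    then have "(1/4)^i * 2 ^ (Suc i * DIM('a)) * (shell_mass DIM('a) * ((1/2)^i)^DIM('a))
        = 2 ^ DIM('a) * shell_mass DIM('a) * (1/4)^i"
      by (simp add: power_add algebra_simps)
    moreover have "emeasure lebesgue {y. x - y \<in> shell i} = ennreal (shell_mass DIM('a) * ((1/2)^i)^DIM('a))"
      unfolding emeasure_eq_measure2[OF measure_shell(2)[of x i]] measure_shell(1)[of x i] shell_mass_def ..
    moreover have "0 \<le> shell_mass DIM('a) * ((1/2)^i)^DIM('a)"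
      using shell_mass_pos[where 'a='a] by simp
    ultimately show "ennreal ((1/4)^i * 2 ^ (Suc i * DIM('a))) * emeasure lebesgue {y. x - y \<in> shell i}
        = ennreal (2 ^ DIM('a) * shell_mass DIM('a) * (1/4)^i)"
      by (metis ennreal_mult'')
  qed
  finally show ?thesis .
qed

text \<open>The integrand of the energy is at most $|x-y|^2 k(x-y)$ and vanishes unless \<open>x\<close> or \<open>y\<close> lies in
  \<open>\<Omega>\<close>. Integrating first in the variable that is not confined to \<open>\<Omega>\<close> leaves the second moment times the
  measure of \<open>\<Omega>\<close>.\<close>

lemma Lipschitz_in_H_space:
  fixes u :: "'a::euclidean_space \<Rightarrow> real"
  assumes \<Omega>: "\<Omega> \<in> lmeasurable" and lip: "\<And>x y. \<bar>u x - u y\<bar> \<le> norm (x - y)"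
    and bound: "\<And>x. \<bar>u x\<bar> \<le> U" and out: "\<And>x. x \<notin> \<Omega> \<Longrightarrow> u x = 0"
  shows "u \<in> H_space \<Omega>"
proof -
  have "continuous_on UNIV u"
  proof (rule continuous_on_iff[THEN iffD2], intro ballI allI impI)
    fix x :: 'a and e :: real assume "e > 0"
    then show "\<exists>d>0. \<forall>x'\<in>UNIV. dist x' x < d \<longrightarrow> dist (u x') (u x) < e"
      using lip by (intro exI[of _ e]) (auto simp: dist_norm intro: le_less_trans)
  qed
  then have "u \<in> borel_measurable borel" by (rule borel_measurable_continuous_onI)
  then have [measurable]: "u \<in> borel_measurable lebesgue"
    by (simp add: measurable_completion)
  have [measurable]: "\<Omega> \<in> sets lebesgue" using \<Omega> by auto
  have [measurable]: "Measurable.pred lebesgue (\<lambda>x. x \<in> \<Omega>)" by simp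
  have ind: "integrable lebesgue (indicator \<Omega> :: 'a \<Rightarrow> real)"
    using \<Omega> by (auto simp: fmeasurable_def)
  have u2: "integrable lebesgue (\<lambda>x. (u x)\<^sup>2)"
  proof (rule Bochner_Integration.integrable_bound)
    show "integrable lebesgue (\<lambda>x. U\<^sup>2 * indicator \<Omega> x)" using ind by simp
    show "AE x in lebesgue. norm ((u x)\<^sup>2) \<le> norm (U\<^sup>2 * indicator \<Omega> x)"
      using bound out by (intro AE_I2) (auto simp: indicator_def abs_le_square_iff[symmetric] intro: order_trans[OF _ abs_ge_self])
  qed simp
  define g :: "'a \<Rightarrow> ennreal" where "g z = ennreal ((norm z)\<^sup>2 * k_kernel z)" for z
  define S :: ennreal where "S = (\<Sum>i. ennreal (2 ^ DIM('a) * shell_mass DIM('a) * (1/4)^i))"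
  have "S < \<infinity>"
    unfolding S_def using shell_mass_pos[where 'a='a]
    by (subst suminf_ennreal2) (auto intro!: summable_mult summable_geometric)
  have [measurable]: "g \<in> borel_measurable borel" unfolding g_def[abs_def] by measurable
  have g_int: "(\<integral>\<^sup>+y. g (x - y) \<partial>lebesgue) \<le> S" for x
    unfolding g_def S_def by (rule nn_integral_second_moment_le)
  have g_comm: "g (x - y) = g (y - x)" for x y
    by (simp add: g_def norm_minus_commute k_kernel_commute)
  have fin: "S * emeasure lebesgue \<Omega> < \<infinity>"
    using \<open>S < \<infinity>\<close> \<Omega> by (auto simp: fmeasurable_def ennreal_mult_less_top)
  have 1: "(\<integral>\<^sup>+p. indicator \<Omega> (fst p) * g (fst p - snd p) \<partial>leb2) \<le> S * emeasure lebesgue \<Omega>"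
  proof -
    have "(\<integral>\<^sup>+p. indicator \<Omega> (fst p) * g (fst p - snd p) \<partial>leb2)
      = (\<integral>\<^sup>+x. \<integral>\<^sup>+y. indicator \<Omega> x * g (x - y) \<partial>lebesgue \<partial>lebesgue)"
      by (subst leb.nn_integral_fst[symmetric]) auto
    also have "\<dots> \<le> (\<integral>\<^sup>+x. S * indicator \<Omega> x \<partial>lebesgue)"
      using g_int by (intro nn_integral_mono) (auto simp: indicator_def)
    finally show ?thesis by (simp add: nn_integral_cmult_indicator)
  qed
  have 2: "(\<integral>\<^sup>+p. indicator \<Omega> (snd p) * g (fst p - snd p) \<partial>leb2) \<le> S * emeasure lebesgue \<Omega>"
  proof -
    have "(\<integral>\<^sup>+p. indicator \<Omega> (snd p) * g (fst p - snd p) \<partial>leb2)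
      = (\<integral>\<^sup>+y. \<integral>\<^sup>+x. indicator \<Omega> y * g (x - y) \<partial>lebesgue \<partial>lebesgue)"
      by (subst leb_pair.nn_integral_snd[symmetric]) auto
    also have "\<dots> \<le> (\<integral>\<^sup>+x. S * indicator \<Omega> x \<partial>lebesgue)"
      using g_int by (intro nn_integral_mono) (auto simp: indicator_def g_comm)
    finally show ?thesis by (simp add: nn_integral_cmult_indicator)
  qed
  have "integrable leb2 (\<lambda>p. (u (fst p) - u (snd p))\<^sup>2 * k_kernel (fst p - snd p))"
  proof (rule integrableI_bounded)
    have "(\<integral>\<^sup>+p. ennreal (norm ((u (fst p) - u (snd p))\<^sup>2 * k_kernel (fst p - snd p))) \<partial>leb2)
      \<le> (\<integral>\<^sup>+p. indicator \<Omega> (fst p) * g (fst p - snd p) + indicator \<Omega> (snd p) * g (fst p - snd p) \<partial>leb2)"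
    proof (intro nn_integral_mono)
      fix p :: "'a \<times> 'a"
      have "ennreal (norm ((u (fst p) - u (snd p))\<^sup>2 * k_kernel (fst p - snd p))) \<le> g (fst p - snd p)"
        using lip[of "fst p" "snd p"] unfolding g_def
        by (auto intro!: ennreal_leI mult_right_mono simp: abs_mult k_kernel_nonneg abs_le_square_iff[symmetric])
      then show "ennreal (norm ((u (fst p) - u (snd p))\<^sup>2 * k_kernel (fst p - snd p)))
        \<le> indicator \<Omega> (fst p) * g (fst p - snd p) + indicator \<Omega> (snd p) * g (fst p - snd p)"
        using out[of "fst p"] out[of "snd p"]
        by (auto simp: indicator_def intro: order_trans)
    qed
    also have "\<dots> \<le> S * emeasure lebesgue \<Omega> + S * emeasure lebesgue \<Omega>"
      using 1 2 by (subst nn_integral_add) (auto intro: add_mono)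
    also have "\<dots> < \<infinity>" using fin by simp
    finally show "(\<integral>\<^sup>+p. ennreal (norm ((u (fst p) - u (snd p))\<^sup>2 * k_kernel (fst p - snd p))) \<partial>leb2) < \<infinity>" .
  qed measurable
  then show ?thesis
    using u2 out by (auto simp: H_space_def split_beta')
qed

section \<open>The energy space and its forms\<close>

lemma c_const_pos: "0 < c_const DIM('a::euclidean_space)"
  unfolding c_const_def by (intro mult_pos_pos Gamma_real_pos) auto

lemma H_spaceD:
  assumes "u \<in> H_space \<Omega>"
  shows "u \<in> borel_measurable lebesgue" "integrable lebesgue (\<lambda>x. (u x)\<^sup>2)"
    "x \<notin> \<Omega> \<Longrightarrow> u x = 0"
    "integrable leb2 (\<lambda>(x, y). (u x - u y)\<^sup>2 * k_kernel (x - y))"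
  using assms by (auto simp: H_space_def)

lemma H_space_integrable_times:
  assumes u: "u \<in> H_space \<Omega>" and v: "v \<in> H_space \<Omega>"
    and b [measurable]: "b \<in> borel_measurable lebesgue" and bound: "\<And>x. \<bar>b x\<bar> \<le> B"
  shows "integrable lebesgue (\<lambda>x. b x * (u x * v x))"
proof (rule Bochner_Integration.integrable_bound)
  note [measurable] = H_spaceD(1)[OF u] H_spaceD(1)[OF v]
  show "integrable lebesgue (\<lambda>x. B * ((u x)\<^sup>2 + (v x)\<^sup>2))"
    using H_spaceD(2)[OF u] H_spaceD(2)[OF v] by auto
  show "(\<lambda>x. b x * (u x * v x)) \<in> borel_measurable lebesgue" by measurable
  have "\<bar>s * t\<bar> \<le> s\<^sup>2 + t\<^sup>2" for s t :: real
  proof -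
    have "2 * \<bar>s\<bar> * \<bar>t\<bar> \<le> s\<^sup>2 + t\<^sup>2" using sum_squares_bound[of "\<bar>s\<bar>" "\<bar>t\<bar>"] by simp
    moreover have "0 \<le> \<bar>s\<bar> * \<bar>t\<bar>" by simp
    ultimately show ?thesis unfolding abs_mult by linarith
  qed
  then have "\<bar>b x * (u x * v x)\<bar> \<le> B * ((u x)\<^sup>2 + (v x)\<^sup>2)" for x
    unfolding abs_mult[of "b x"] using bound[of x] by (intro mult_mono) auto
  then show "AE x in lebesgue. norm (b x * (u x * v x)) \<le> norm (B * ((u x)\<^sup>2 + (v x)\<^sup>2))"
    by (intro AE_I2) (auto intro: order_trans[OF _ abs_ge_self])
qed

lemma H_space_integrable:
  assumes \<Omega>: "\<Omega> \<in> lmeasurable" and u: "u \<in> H_space \<Omega>"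
  shows "integrable lebesgue u"
proof (rule Bochner_Integration.integrable_bound)
  show "integrable lebesgue (\<lambda>x. indicator \<Omega> x + (u x)\<^sup>2)"
    using H_spaceD(2)[OF u] \<Omega> by (auto simp: fmeasurable_def)
  show "u \<in> borel_measurable lebesgue" by (rule H_spaceD[OF u])
  have "\<bar>t\<bar> \<le> 1 + t\<^sup>2" for t :: real
    using sum_squares_bound[of "\<bar>t\<bar>" 1] by auto
  then show "AE x in lebesgue. norm (u x) \<le> norm (indicator \<Omega> x + (u x)\<^sup>2)"
    using H_spaceD(3)[OF u] by (intro AE_I2) (auto simp: indicator_def)
qed

lemma H_space_integrable_form:
  assumes u: "u \<in> H_space \<Omega>" and v: "v \<in> H_space \<Omega>"
  shows "integrable leb2 (\<lambda>p. (u (fst p) - u (snd p)) * (v (fst p) - v (snd p)) * k_kernel (fst p - snd p))"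
proof (rule Bochner_Integration.integrable_bound)
  note [measurable] = H_spaceD(1)[OF u] H_spaceD(1)[OF v]
  show "integrable leb2 (\<lambda>p. (u (fst p) - u (snd p))\<^sup>2 * k_kernel (fst p - snd p)
      + (v (fst p) - v (snd p))\<^sup>2 * k_kernel (fst p - snd p))"
    using H_spaceD(4)[OF u] H_spaceD(4)[OF v] by (auto simp: split_beta')
  show "(\<lambda>p. (u (fst p) - u (snd p)) * (v (fst p) - v (snd p)) * k_kernel (fst p - snd p))
    \<in> borel_measurable leb2" by measurable
  have "\<bar>s * t * k\<bar> \<le> \<bar>s\<^sup>2 * k + t\<^sup>2 * k\<bar>" if "0 \<le> k" for s t k :: real
  proof -
    have "2 * \<bar>s\<bar> * \<bar>t\<bar> \<le> s\<^sup>2 + t\<^sup>2" using sum_squares_bound[of "\<bar>s\<bar>" "\<bar>t\<bar>"] by simp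
    moreover have "0 \<le> \<bar>s\<bar> * \<bar>t\<bar>" by simp
    ultimately have "\<bar>s * t\<bar> \<le> s\<^sup>2 + t\<^sup>2" unfolding abs_mult by linarith
    from mult_right_mono[OF this that] that show ?thesis by (simp add: abs_mult algebra_simps)
  qed
  then show "AE p in leb2. norm ((u (fst p) - u (snd p)) * (v (fst p) - v (snd p)) * k_kernel (fst p - snd p))
    \<le> norm ((u (fst p) - u (snd p))\<^sup>2 * k_kernel (fst p - snd p)
      + (v (fst p) - v (snd p))\<^sup>2 * k_kernel (fst p - snd p))"
    by (intro AE_I2) (simp add: k_kernel_nonneg)
qed

text \<open>The kernel \<open>j_kernel\<close> is bounded by 1 but not integrable at infinity; what makes the form finite
  is the integrability of both functions.\<close>

lemma integrable_j_form:
  fixes f g :: "'a::euclidean_space \<Rightarrow> real"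
  assumes f: "integrable lebesgue f" and g: "integrable lebesgue g"
  shows "integrable leb2 (\<lambda>p. f (fst p) * g (snd p) * j_kernel (fst p - snd p))"
    and "\<bar>LINT p|leb2. f (fst p) * g (snd p) * j_kernel (fst p - snd p)\<bar>
      \<le> (LINT x|lebesgue. \<bar>f x\<bar>) * (LINT x|lebesgue. \<bar>g x\<bar>)"
proof -
  have [measurable]: "f \<in> borel_measurable lebesgue" "g \<in> borel_measurable lebesgue"
    using f g by auto
  have prod: "integrable leb2 (\<lambda>p. \<bar>f (fst p)\<bar> * \<bar>g (snd p)\<bar>)"
    using integrable_leb2_times(1)[of "\<lambda>x. \<bar>f x\<bar>" "\<lambda>x. \<bar>g x\<bar>"] f g by (simp add: split_beta')
  have le: "\<bar>f x * g y * j_kernel z\<bar> \<le> \<bar>f x\<bar> * \<bar>g y\<bar>" for x y and z :: 'a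
    using mult_left_mono[OF j_kernel_le_1, of "\<bar>f x\<bar> * \<bar>g y\<bar>"]
    by (simp add: abs_mult j_kernel_nonneg)
  show *: "integrable leb2 (\<lambda>p. f (fst p) * g (snd p) * j_kernel (fst p - snd p))"
    by (rule Bochner_Integration.integrable_bound[OF prod]) (auto simp: le intro!: AE_I2 order_trans[OF le])
  have "\<bar>LINT p|leb2. f (fst p) * g (snd p) * j_kernel (fst p - snd p)\<bar>
    \<le> (LINT p|leb2. \<bar>f (fst p) * g (snd p) * j_kernel (fst p - snd p)\<bar>)"
    using integral_norm_bound by fastforce
  also have "\<dots> \<le> (LINT p|leb2. \<bar>f (fst p)\<bar> * \<bar>g (snd p)\<bar>)"
    by (intro integral_mono) (use * prod le in auto)
  also have "\<dots> = (LINT x|lebesgue. \<bar>f x\<bar>) * (LINT x|lebesgue. \<bar>g x\<bar>)"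
    using integrable_leb2_times(2)[of "\<lambda>x. \<bar>f x\<bar>" "\<lambda>x. \<bar>g x\<bar>"] f g by (simp add: split_beta')
  finally show "\<bar>LINT p|leb2. f (fst p) * g (snd p) * j_kernel (fst p - snd p)\<bar>
      \<le> (LINT x|lebesgue. \<bar>f x\<bar>) * (LINT x|lebesgue. \<bar>g x\<bar>)" .
qed

lemma j_form_commute:
  fixes f g :: "'a::euclidean_space \<Rightarrow> real"
  assumes [measurable]: "f \<in> borel_measurable lebesgue" "g \<in> borel_measurable lebesgue"
  shows "(LINT p|leb2. f (fst p) * g (snd p) * j_kernel (fst p - snd p))
    = (LINT p|leb2. g (fst p) * f (snd p) * j_kernel (fst p - snd p))"
  using leb_pair.integral_product_swap[of "\<lambda>p. f (fst p) * g (snd p) * j_kernel (fst p - snd p)"]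
  by (simp add: split_beta' j_kernel_commute[of "snd _" "fst _"] mult.commute)

text \<open>All closure properties of the energy space that occur below are instances of this domination by
  two elements.\<close>

lemma H_space_comparison:
  assumes u: "u \<in> H_space \<Omega>" and v: "v \<in> H_space \<Omega>"
    and meas [measurable]: "f \<in> borel_measurable lebesgue"
    and val: "\<And>x. \<bar>f x\<bar> \<le> A * (\<bar>u x\<bar> + \<bar>v x\<bar>)"
    and diff: "\<And>x y. \<bar>f x - f y\<bar> \<le> A * (\<bar>u x - u y\<bar> + \<bar>v x - v y\<bar>)"
  shows "f \<in> H_space \<Omega>"
proof -
  have sq: "t\<^sup>2 \<le> 2 * A\<^sup>2 * (r\<^sup>2 + s\<^sup>2)" if "\<bar>t\<bar> \<le> A * (\<bar>r\<bar> + \<bar>s\<bar>)" for r s t :: real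
  proof -
    have "t\<^sup>2 \<le> (A * (\<bar>r\<bar> + \<bar>s\<bar>))\<^sup>2" using power_mono[OF that, of 2] by simp
    also have "\<dots> = A\<^sup>2 * (\<bar>r\<bar> + \<bar>s\<bar>)\<^sup>2" by (simp add: power_mult_distrib)
    also have "\<dots> \<le> A\<^sup>2 * (2 * (r\<^sup>2 + s\<^sup>2))"
      using sum_squares_bound[of "\<bar>r\<bar>" "\<bar>s\<bar>"] by (intro mult_left_mono) (auto simp: power2_sum)
    finally show ?thesis by (simp add: algebra_simps)
  qed
  have "f x = 0" if "x \<notin> \<Omega>" for x
    using val[of x] H_spaceD(3)[OF u that] H_spaceD(3)[OF v that] by simp
  moreover have "integrable lebesgue (\<lambda>x. (f x)\<^sup>2)"
  proof (rule Bochner_Integration.integrable_bound)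
    show "integrable lebesgue (\<lambda>x. 2 * A\<^sup>2 * ((u x)\<^sup>2 + (v x)\<^sup>2))"
      using H_spaceD(2)[OF u] H_spaceD(2)[OF v] by auto
    show "AE x in lebesgue. norm ((f x)\<^sup>2) \<le> norm (2 * A\<^sup>2 * ((u x)\<^sup>2 + (v x)\<^sup>2))"
      using sq[OF val] by (intro AE_I2) (auto intro: order_trans[OF _ abs_ge_self])
  qed measurable
  moreover have "integrable leb2 (\<lambda>p. (f (fst p) - f (snd p))\<^sup>2 * k_kernel (fst p - snd p))"
  proof (rule Bochner_Integration.integrable_bound)
    show "integrable leb2 (\<lambda>p. 2 * A\<^sup>2 * ((u (fst p) - u (snd p))\<^sup>2 * k_kernel (fst p - snd p)
        + (v (fst p) - v (snd p))\<^sup>2 * k_kernel (fst p - snd p)))"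
      using H_spaceD(4)[OF u] H_spaceD(4)[OF v] by (auto simp: split_beta')
    have "\<bar>(f x - f y)\<^sup>2 * k_kernel (x - y)\<bar>
      \<le> 2 * A\<^sup>2 * ((u x - u y)\<^sup>2 * k_kernel (x - y) + (v x - v y)\<^sup>2 * k_kernel (x - y))" for x y
      using mult_right_mono[OF sq[OF diff[of x y]] k_kernel_nonneg[of "x - y"]]
      by (simp add: abs_mult k_kernel_nonneg algebra_simps)
    then show "AE p in leb2. norm ((f (fst p) - f (snd p))\<^sup>2 * k_kernel (fst p - snd p))
      \<le> norm (2 * A\<^sup>2 * ((u (fst p) - u (snd p))\<^sup>2 * k_kernel (fst p - snd p)
        + (v (fst p) - v (snd p))\<^sup>2 * k_kernel (fst p - snd p)))"
      by (intro AE_I2) (auto intro: order_trans[OF _ abs_ge_self])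
  qed measurable
  ultimately show ?thesis
    by (auto simp: H_space_def split_beta')
qed

lemma H_space_cmult:
  assumes u: "u \<in> H_space \<Omega>" shows "(\<lambda>x. c * u x) \<in> H_space \<Omega>"
proof (rule H_space_comparison[OF u u, where A = "\<bar>c\<bar>"])
  note [measurable] = H_spaceD(1)[OF u]
  show "(\<lambda>x. c * u x) \<in> borel_measurable lebesgue" by measurable
  show "\<bar>c * u x\<bar> \<le> \<bar>c\<bar> * (\<bar>u x\<bar> + \<bar>u x\<bar>)" for x
    unfolding abs_mult by (intro mult_left_mono) auto
  show "\<bar>c * u x - c * u y\<bar> \<le> \<bar>c\<bar> * (\<bar>u x - u y\<bar> + \<bar>u x - u y\<bar>)" for x y
    unfolding right_diff_distrib[symmetric] abs_mult by (intro mult_left_mono) auto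
qed

lemma H_space_abs:
  assumes u: "u \<in> H_space \<Omega>" shows "(\<lambda>x. \<bar>u x\<bar>) \<in> H_space \<Omega>"
proof (rule H_space_comparison[OF u u, where A = 1])
  show "(\<lambda>x. \<bar>u x\<bar>) \<in> borel_measurable lebesgue" using H_spaceD(1)[OF u] by simp
  show "\<bar>\<bar>u x\<bar> - \<bar>u y\<bar>\<bar> \<le> 1 * (\<bar>u x - u y\<bar> + \<bar>u x - u y\<bar>)" for x y
    by (rule order_trans[OF abs_triangle_ineq3]) simp
qed simp

text \<open>The admissible test functions. Adding \<open>d\<close> keeps the denominator away from zero, and boundedness of
  \<open>u\<close> makes the quotient Lipschitz in the pair \<open>(u, v)\<close>.\<close>

lemma H_space_quotient:
  assumes u: "u \<in> H_space \<Omega>" and v: "v \<in> H_space \<Omega>" and v0: "\<And>x. 0 \<le> v x"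
    and bound: "\<And>x. \<bar>u x\<bar> \<le> U" and d: "0 < d"
  shows "(\<lambda>x. (u x)\<^sup>2 / (v x + d)) \<in> H_space \<Omega>"
proof (rule H_space_comparison[OF u v, where A = "2 * U / d + U\<^sup>2 / d\<^sup>2"])
  note [measurable] = H_spaceD(1)[OF u] H_spaceD(1)[OF v]
  have U: "0 \<le> U" using bound[of undefined] by linarith
  show "(\<lambda>x. (u x)\<^sup>2 / (v x + d)) \<in> borel_measurable lebesgue" by measurable
  fix x
  have "\<bar>(u x)\<^sup>2 / (v x + d)\<bar> \<le> U * \<bar>u x\<bar> / d"
    unfolding abs_divide power2_eq_square abs_mult
    using v0[of x] d bound[of x] by (intro frac_le mult_mono) auto
  also have "\<dots> \<le> (2 * U / d + U\<^sup>2 / d\<^sup>2) * \<bar>u x\<bar>"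
    using U d by (simp add: distrib_right add_increasing2 divide_right_mono)
  also have "\<dots> \<le> (2 * U / d + U\<^sup>2 / d\<^sup>2) * (\<bar>u x\<bar> + \<bar>v x\<bar>)"
    using U d by (intro mult_left_mono) auto
  finally show "\<bar>(u x)\<^sup>2 / (v x + d)\<bar> \<le> (2 * U / d + U\<^sup>2 / d\<^sup>2) * (\<bar>u x\<bar> + \<bar>v x\<bar>)" .
  fix y
  have pos: "0 < v x + d" "0 < v y + d" using v0[of x] v0[of y] d by auto
  have 1: "\<bar>(u x - u y) * (u x + u y) / (v x + d)\<bar> \<le> (2 * U / d) * \<bar>u x - u y\<bar>"
  proof -
    have "\<bar>(u x - u y) * (u x + u y) / (v x + d)\<bar> \<le> \<bar>u x - u y\<bar> * (2 * U) / d"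
      unfolding abs_divide abs_mult using v0[of x] d bound[of x] bound[of y]
      by (intro frac_le mult_mono) auto
    then show ?thesis by (simp add: mult.commute)
  qed
  have 2: "\<bar>(u y)\<^sup>2 * (v y - v x) / ((v x + d) * (v y + d))\<bar> \<le> (U\<^sup>2 / d\<^sup>2) * \<bar>v x - v y\<bar>"
  proof -
    have "d\<^sup>2 \<le> (v x + d) * (v y + d)"
      unfolding power2_eq_square using v0[of x] v0[of y] d by (intro mult_mono) auto
    moreover have "(u y)\<^sup>2 \<le> U\<^sup>2" using bound[of y] power_mono[of "\<bar>u y\<bar>" U 2] by simp
    ultimately have "\<bar>(u y)\<^sup>2 * (v y - v x) / ((v x + d) * (v y + d))\<bar> \<le> U\<^sup>2 * \<bar>v x - v y\<bar> / d\<^sup>2"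
      unfolding abs_divide abs_mult[of "(u y)\<^sup>2"] abs_minus_commute[of "v x"] using d
      by (intro frac_le mult_mono) (auto intro: order_trans[OF _ abs_ge_self])
    then show ?thesis by (simp add: mult.commute)
  qed
  have "(u x)\<^sup>2 / (v x + d) - (u y)\<^sup>2 / (v y + d) =
     (u x - u y) * (u x + u y) / (v x + d) + (u y)\<^sup>2 * (v y - v x) / ((v x + d) * (v y + d))"
    using pos by (simp add: divide_simps) (simp add: algebra_simps power2_eq_square)
  then have "\<bar>(u x)\<^sup>2 / (v x + d) - (u y)\<^sup>2 / (v y + d)\<bar>
      \<le> (2 * U / d) * \<bar>u x - u y\<bar> + (U\<^sup>2 / d\<^sup>2) * \<bar>v x - v y\<bar>"
    using 1 2 by linarith
  also have "\<dots> \<le> (2 * U / d + U\<^sup>2 / d\<^sup>2) * (\<bar>u x - u y\<bar> + \<bar>v x - v y\<bar>)"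
    using U d by (auto simp: distrib_left distrib_right intro!: add_mono)
  finally show "\<bar>(u x)\<^sup>2 / (v x + d) - (u y)\<^sup>2 / (v y + d)\<bar>
      \<le> (2 * U / d + U\<^sup>2 / d\<^sup>2) * (\<bar>u x - u y\<bar> + \<bar>v x - v y\<bar>)" .
qed

section \<open>A Picone inequality for solutions\<close>

text \<open>With $V = v + d$ and $w = u/V$ this is $V(x)V(y)(w(x)-w(y))^2$, the defect in the discrete Picone
  inequality.\<close>

definition picone_remainder :: "real \<Rightarrow> ('a \<Rightarrow> real) \<Rightarrow> ('a \<Rightarrow> real) \<Rightarrow> 'a \<Rightarrow> 'a \<Rightarrow> real" where
  "picone_remainder d u v x y = (u x * (v y + d) - u y * (v x + d))\<^sup>2 / ((v x + d) * (v y + d))"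

lemma picone_remainder_nonneg:
  assumes "\<And>x. 0 \<le> v x" "0 < d"
  shows "0 \<le> picone_remainder d u v x y"
proof -
  have "0 \<le> (v x + d) * (v y + d)" using assms(1)[of x] assms(1)[of y] assms(2) by simp
  then show ?thesis by (simp add: picone_remainder_def)
qed

text \<open>The first identity serves the energy, which contains differences, and the second one the
  products integrated against \<open>j_kernel\<close>. That integral enters \<open>EL_form\<close> with a minus sign, so the
  remainder contributes with the same sign for both kernels.\<close>

lemma picone_identity:
  assumes "0 < v x + d" "0 < v y + d"
  shows "(v x - v y) * ((u x)\<^sup>2 / (v x + d) - (u y)\<^sup>2 / (v y + d))
      = (u x - u y)\<^sup>2 - picone_remainder d u v x y"
    and "v x * ((u y)\<^sup>2 / (v y + d)) + (u x)\<^sup>2 / (v x + d) * v y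
      = picone_remainder d u v x y + 2 * (u x * u y)
        - d * ((u x)\<^sup>2 / (v x + d)) - d * ((u y)\<^sup>2 / (v y + d))"
proof -
  define X Y where "X = v x + d" and "Y = v y + d"
  have XY: "X > 0" "Y > 0" "v x = X - d" "v y = Y - d" using assms by (auto simp: X_def Y_def)
  show "(v x - v y) * ((u x)\<^sup>2 / (v x + d) - (u y)\<^sup>2 / (v y + d))
      = (u x - u y)\<^sup>2 - picone_remainder d u v x y"
    using XY(1,2) unfolding picone_remainder_def XY(3,4)
    by (simp add: divide_simps) (simp add: algebra_simps power2_eq_square)
  show "v x * ((u y)\<^sup>2 / (v y + d)) + (u x)\<^sup>2 / (v x + d) * v y
      = picone_remainder d u v x y + 2 * (u x * u y)
        - d * ((u x)\<^sup>2 / (v x + d)) - d * ((u y)\<^sup>2 / (v y + d))"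
    using XY(1,2) unfolding picone_remainder_def XY(3,4)
    by (simp add: divide_simps) (simp add: algebra_simps power2_eq_square)
qed

lemma EL_form_alt:
  fixes u v :: "'a::euclidean_space \<Rightarrow> real"
  shows "EL_form u v = c_const DIM('a) / 2 *
     (LINT p|leb2. (u (fst p) - u (snd p)) * (v (fst p) - v (snd p)) * k_kernel (fst p - snd p))
     - c_const DIM('a) * (LINT p|leb2. u (fst p) * v (snd p) * j_kernel (fst p - snd p))
     + rho_const DIM('a) * (LINT x|lebesgue. u x * v x)"
  by (simp add: EL_form_def E_form_def split_beta')

text \<open>Test the equation for \<open>v\<close> with $u^2/(v+d)$. The Picone identities turn the two double integrals into
  those of \<open>EL_form u u\<close> minus the remainder, and replacing $v$ by $v+d$ in the lower order terms costs at most a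
  constant times $\int u^2 d/(v+d)$. The constant does not depend on \<open>u\<close> or \<open>d\<close>, which is what allows \<open>d\<close> to tend
  to zero separately for each \<open>u\<close>. The remainder against \<open>j_kernel\<close> is in general integrable only on
  $\Omega\times\Omega$, hence the indicators.\<close>

lemma picone_inequality:
  fixes u v b :: "'a::euclidean_space \<Rightarrow> real"
  assumes \<Omega>: "\<Omega> \<in> lmeasurable" and v: "v \<in> H_space \<Omega>" and v0: "\<And>x. 0 \<le> v x"
    and b [measurable]: "b \<in> borel_measurable lebesgue" and B: "\<And>x. \<bar>b x\<bar> \<le> B"
    and weak: "\<And>\<phi>. \<phi> \<in> H_space \<Omega> \<Longrightarrow> EL_form v \<phi> = (LINT x|lebesgue. b x * (v x * \<phi> x))"
    and u: "u \<in> H_space \<Omega>" and U: "\<And>x. \<bar>u x\<bar> \<le> U" and d: "0 < d"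
  defines "R \<equiv> \<lambda>p. indicator \<Omega> (fst p) * indicator \<Omega> (snd p) * picone_remainder d u v (fst p) (snd p)
      * (k_kernel (fst p - snd p) + j_kernel (fst p - snd p))"
  shows "integrable leb2 R"
    and "c_const DIM('a) / 2 * (LINT p|leb2. R p) \<le> EL_form u u - (LINT x|lebesgue. b x * (u x)\<^sup>2)
      + (B + \<bar>rho_const DIM('a)\<bar> + c_const DIM('a) * measure lebesgue \<Omega>)
        * (LINT x|lebesgue. (u x)\<^sup>2 * (d / (v x + d)))"
proof -
  note [measurable] = H_spaceD(1)[OF u] H_spaceD(1)[OF v]
  have [measurable]: "\<Omega> \<in> sets lebesgue" using \<Omega> by auto
  \<comment> \<open>The products of \<open>v\<close> with \<open>\<phi>\<close> differ from $u^2$ by exactly \<open>d * \<phi>\<close>, which is the source of the error term.\<close>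
  define \<phi> where "\<phi> x = (u x)\<^sup>2 / (v x + d)" for x
  have \<phi>: "\<phi> \<in> H_space \<Omega>" unfolding \<phi>_def[abs_def] by (rule H_space_quotient[OF u v v0 U d])
  note [measurable] = H_spaceD(1)[OF \<phi>]
  have pos: "0 < v x + d" for x using v0[of x] d by linarith
  have \<phi>0: "0 \<le> \<phi> x" for x using pos[of x] by (simp add: \<phi>_def)
  define P where "P p = picone_remainder d u v (fst p) (snd p)" for p
  have P0: "0 \<le> P p" for p by (simp add: P_def picone_remainder_nonneg v0 d)
  have [measurable]: "P \<in> borel_measurable leb2"
    unfolding P_def[abs_def] picone_remainder_def by measurable
  define ii :: "'a \<times> 'a \<Rightarrow> real" where "ii p = indicator \<Omega> (fst p) * indicator \<Omega> (snd p)" for p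
  have [measurable]: "ii \<in> borel_measurable leb2" unfolding ii_def[abs_def] by measurable
  have ii: "0 \<le> ii p" "ii p \<le> 1" for p by (auto simp: ii_def indicator_def)
  have ind: "integrable lebesgue (indicator \<Omega> :: 'a \<Rightarrow> real)" using \<Omega> by (auto simp: fmeasurable_def)
  let ?k = "\<lambda>p. k_kernel (fst p - snd p :: 'a)" and ?j = "\<lambda>p. j_kernel (fst p - snd p :: 'a)"
  define Iuu where "Iuu p = (u (fst p) - u (snd p)) * (u (fst p) - u (snd p)) * ?k p" for p
  define Iv where "Iv p = (v (fst p) - v (snd p)) * (\<phi> (fst p) - \<phi> (snd p)) * ?k p" for p
  have Iuu: "integrable leb2 Iuu" unfolding Iuu_def[abs_def] by (rule H_space_integrable_form[OF u u])
  have Iv: "integrable leb2 Iv" unfolding Iv_def[abs_def] by (rule H_space_integrable_form[OF v \<phi>])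
  have Pk: "P p * ?k p = Iuu p - Iv p" for p
  proof -
    have "P p = (u (fst p) - u (snd p)) * (u (fst p) - u (snd p)) - (v (fst p) - v (snd p)) * (\<phi> (fst p) - \<phi> (snd p))"
      using picone_identity(1)[of v "fst p" d "snd p" u] pos
      unfolding P_def \<phi>_def by (simp add: power2_eq_square)
    then show ?thesis by (simp add: Iuu_def Iv_def left_diff_distrib)
  qed
  have intPk: "integrable leb2 (\<lambda>p. P p * ?k p)" unfolding Pk using Iuu Iv by simp
  have intRk: "integrable leb2 (\<lambda>p. ii p * P p * ?k p)"
  proof (rule Bochner_Integration.integrable_bound[OF intPk])
    show "AE p in leb2. norm (ii p * P p * ?k p) \<le> norm (P p * ?k p)"
      using ii P0 by (intro AE_I2) (simp add: abs_mult k_kernel_nonneg mult_left_le_one_le mult_right_mono)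
  qed measurable
  have Rk_le: "(LINT p|leb2. ii p * P p * ?k p) \<le> (LINT p|leb2. Iuu p) - (LINT p|leb2. Iv p)"
  proof -
    have "(LINT p|leb2. ii p * P p * ?k p) \<le> (LINT p|leb2. P p * ?k p)"
      using ii P0
      by (intro integral_mono intRk intPk mult_right_mono k_kernel_nonneg) (simp add: mult_left_le_one_le)
    also have "\<dots> = (LINT p|leb2. Iuu p) - (LINT p|leb2. Iv p)"
      unfolding Pk using Iuu Iv by simp
    finally show ?thesis .
  qed
  note L1 = H_space_integrable[OF \<Omega> u] H_space_integrable[OF \<Omega> v] H_space_integrable[OF \<Omega> \<phi>]
  define J where "J f g p = f (fst p) * g (snd p) * ?j p" for f g :: "'a \<Rightarrow> real" and p
  have J: "integrable leb2 (J f g)" if "integrable lebesgue f" "integrable lebesgue g" for f g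
    unfolding J_def[abs_def] using that by (rule integrable_j_form)
  have Pj: "ii p * P p * ?j p
    = J v \<phi> p + J \<phi> v p - 2 * J u u p + d * (J \<phi> (indicator \<Omega>) p + J (indicator \<Omega>) \<phi> p)" for p
  proof (cases "fst p \<in> \<Omega> \<and> snd p \<in> \<Omega>")
    case True
    have P_eq: "P p = v (fst p) * \<phi> (snd p) + \<phi> (fst p) * v (snd p) - 2 * (u (fst p) * u (snd p))
        + d * (\<phi> (fst p) + \<phi> (snd p))"
      using picone_identity(2)[of v "fst p" d "snd p" u] pos
      unfolding P_def \<phi>_def by (simp add: algebra_simps)
    from True show ?thesis by (simp add: J_def ii_def P_eq) (simp add: algebra_simps)
  next
    case False
    then show ?thesis
      using H_spaceD(3)[OF u] H_spaceD(3)[OF v] H_spaceD(3)[OF \<phi>]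
      by (auto simp: J_def ii_def)
  qed
  have intRj: "integrable leb2 (\<lambda>p. ii p * P p * ?j p)"
    unfolding Pj by (intro Bochner_Integration.integrable_add Bochner_Integration.integrable_diff
      integrable_mult_right J L1 ind)
  have Jcomm: "(LINT p|leb2. J f g p) = (LINT p|leb2. J g f p)"
    if "integrable lebesgue f" "integrable lebesgue g" for f g
    unfolding J_def using that by (intro j_form_commute) auto
  have Rj: "(LINT p|leb2. ii p * P p * ?j p)
    = 2 * (LINT p|leb2. J v \<phi> p) - 2 * (LINT p|leb2. J u u p) + 2 * d * (LINT p|leb2. J (indicator \<Omega>) \<phi> p)"
    unfolding Pj using J L1 ind
    by (simp add: Jcomm[of \<phi> v] Jcomm[of \<phi> "indicator \<Omega>"] L1 ind)
  have J1: "(LINT p|leb2. J (indicator \<Omega>) \<phi> p) \<le> measure lebesgue \<Omega> * (LINT x|lebesgue. \<phi> x)"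
    using integrable_j_form(2)[OF ind L1(3)] \<phi>0 unfolding J_def by simp
  have R_eq: "R p = ii p * P p * ?k p + ii p * P p * ?j p" for p
    by (simp add: R_def ii_def P_def algebra_simps)
  show "integrable leb2 R"
    using intRk intRj by (simp add: R_eq[abs_def])
  have R_int: "(LINT p|leb2. R p) = (LINT p|leb2. ii p * P p * ?k p) + (LINT p|leb2. ii p * P p * ?j p)"
    unfolding R_eq using intRk intRj by simp
  let ?\<rho> = "rho_const DIM('a)" and ?c = "c_const DIM('a)"
  have c: "0 < ?c" by (rule c_const_pos)
  have ELv: "?c / 2 * (LINT p|leb2. Iv p) - ?c * (LINT p|leb2. J v \<phi> p) + ?\<rho> * (LINT x|lebesgue. v x * \<phi> x)
    = (LINT x|lebesgue. b x * (v x * \<phi> x))"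
    using weak[OF \<phi>] unfolding EL_form_alt Iv_def J_def .
  have ELu: "EL_form u u = ?c / 2 * (LINT p|leb2. Iuu p) - ?c * (LINT p|leb2. J u u p)
      + ?\<rho> * (LINT x|lebesgue. u x * u x)"
    unfolding EL_form_alt Iuu_def J_def ..
  have uu: "u x * u x = v x * \<phi> x + d * \<phi> x" for x
  proof -
    have "u x * u x = (v x + d) * \<phi> x"
      using pos[of x] by (simp add: \<phi>_def power2_eq_square)
    then show ?thesis by (simp add: distrib_right)
  qed
  have intv: "integrable lebesgue (\<lambda>x. v x * \<phi> x)"
    using H_space_integrable_times[OF v \<phi>, of "\<lambda>_. 1" 1] by simp
  have int\<phi>: "integrable lebesgue (\<lambda>x. b x * \<phi> x)"
    using Bochner_Integration.integrable_bound[of lebesgue "\<lambda>x. B * \<phi> x" "\<lambda>x. b x * \<phi> x"] L1(3) B \<phi>0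
    by (simp add: abs_mult mult_right_mono order_trans[OF B abs_ge_self])
  have int_uu: "(LINT x|lebesgue. u x * u x) = (LINT x|lebesgue. v x * \<phi> x) + d * (LINT x|lebesgue. \<phi> x)"
    unfolding uu using intv L1(3) by simp
  have "(LINT x|lebesgue. b x * (u x)\<^sup>2)
      = (LINT x|lebesgue. b x * (v x * \<phi> x) + d * (b x * \<phi> x))"
    unfolding power2_eq_square uu by (simp add: algebra_simps)
  also have "\<dots> = (LINT x|lebesgue. b x * (v x * \<phi> x)) + d * (LINT x|lebesgue. b x * \<phi> x)"
    using H_space_integrable_times[OF v \<phi> b B] int\<phi> by simp
  finally have int_buu: "(LINT x|lebesgue. b x * (u x)\<^sup>2)
    = (LINT x|lebesgue. b x * (v x * \<phi> x)) + d * (LINT x|lebesgue. b x * \<phi> x)" .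
  define S where "S = d * (LINT x|lebesgue. \<phi> x)"
  have S0: "0 \<le> S" unfolding S_def using d \<phi>0 by simp
  have "(LINT x|lebesgue. b x * \<phi> x) \<le> (LINT x|lebesgue. B * \<phi> x)"
    using L1(3) int\<phi> \<phi>0 B by (intro integral_mono mult_right_mono) (auto intro: order_trans[OF abs_ge_self])
  then have bS: "d * (LINT x|lebesgue. b x * \<phi> x) \<le> B * S"
    using d L1(3) by (simp add: S_def algebra_simps mult_left_mono)
  have jS: "?c * (d * (LINT p|leb2. J (indicator \<Omega>) \<phi> p)) \<le> ?c * measure lebesgue \<Omega> * S"
    using mult_left_mono[OF J1, of "?c * d"] c d by (simp add: S_def algebra_simps)
  have rS: "- ?\<rho> * S \<le> \<bar>?\<rho>\<bar> * S" using S0 by (intro mult_right_mono) auto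
  have "?c / 2 * (LINT p|leb2. R p) \<le> ?c / 2 * ((LINT p|leb2. Iuu p) - (LINT p|leb2. Iv p)
      + (2 * (LINT p|leb2. J v \<phi> p) - 2 * (LINT p|leb2. J u u p) + 2 * d * (LINT p|leb2. J (indicator \<Omega>) \<phi> p)))"
    unfolding R_int Rj using Rk_le c by (intro mult_left_mono) auto
  also have "\<dots> = EL_form u u - (LINT x|lebesgue. b x * (u x)\<^sup>2)
      + d * (LINT x|lebesgue. b x * \<phi> x) - ?\<rho> * S + ?c * (d * (LINT p|leb2. J (indicator \<Omega>) \<phi> p))"
    unfolding ELu int_uu int_buu ELv[symmetric] S_def by (simp add: algebra_simps)
  also have "\<dots> \<le> EL_form u u - (LINT x|lebesgue. b x * (u x)\<^sup>2)
      + (B + \<bar>?\<rho>\<bar> + ?c * measure lebesgue \<Omega>) * S"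
    using bS jS rS by (simp add: algebra_simps)
  also have "S = (LINT x|lebesgue. (u x)\<^sup>2 * (d / (v x + d)))"
    unfolding S_def \<phi>_def by (simp add: mult.commute flip: integral_mult_right_zero)
  finally show "?c / 2 * (LINT p|leb2. R p) \<le> EL_form u u - (LINT x|lebesgue. b x * (u x)\<^sup>2)
      + (B + \<bar>?\<rho>\<bar> + ?c * measure lebesgue \<Omega>) * (LINT x|lebesgue. (u x)\<^sup>2 * (d / (v x + d)))" .
qed

lemma tendsto_half_power: "(\<lambda>n. (1/2::real)^n) \<longlonglongrightarrow> 0"
  by (rule LIMSEQ_realpow_zero) auto

lemma not_AE_obtain:
  assumes "AE x in M. P x" "\<not> (AE x in M. Q x)"
  obtains x where "P x" "\<not> Q x"
proof -
  have "\<exists>x. P x \<and> \<not> Q x"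
  proof (rule ccontr)
    assume "\<not> (\<exists>x. P x \<and> \<not> Q x)"
    then have "AE x in M. Q x" using assms(1) by (auto elim: eventually_mono)
    with assms(2) show False by simp
  qed
  then show ?thesis using that by blast
qed

section \<open>Strong maximum principle\<close>

text \<open>The comparison function of the strong maximum principle: it has to be nonzero on all of \<open>\<Omega>\<close>, so that
  it detects every set of zeros of positive measure.\<close>

lemma infdist_Compl_in_H_space:
  fixes \<Omega> :: "'a::euclidean_space set"
  assumes "open \<Omega>" "bounded \<Omega>"
  shows "(\<lambda>x. infdist x (- \<Omega>)) \<in> H_space \<Omega>"
    and "\<exists>U. \<forall>x. \<bar>infdist x (- \<Omega>)\<bar> \<le> U"
    and "x \<in> \<Omega> \<Longrightarrow> 0 < infdist x (- \<Omega>)"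
proof -
  have ne: "- \<Omega> \<noteq> {}" using assms(2) not_bounded_UNIV by (metis Compl_empty_eq double_complement)
  then obtain z where z: "z \<in> - \<Omega>" by blast
  obtain e where e: "\<And>x. x \<in> \<Omega> \<Longrightarrow> dist z x \<le> e"
    using assms(2) bounded_any_center[of \<Omega> z] by blast
  have "\<bar>infdist x (- \<Omega>)\<bar> \<le> \<bar>e\<bar>" for x
  proof (cases "x \<in> \<Omega>")
    case True
    have "infdist x (- \<Omega>) \<le> dist x z" using z by (rule infdist_le)
    with e[OF True] infdist_nonneg[of x "- \<Omega>"] show ?thesis by (simp add: dist_commute)
  qed simp
  then show "\<exists>U. \<forall>x. \<bar>infdist x (- \<Omega>)\<bar> \<le> U" by blast
  then obtain U where U: "\<And>x. \<bar>infdist x (- \<Omega>)\<bar> \<le> U" by blast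
  show "(\<lambda>x. infdist x (- \<Omega>)) \<in> H_space \<Omega>"
  proof (rule Lipschitz_in_H_space[OF _ _ U])
    show "\<Omega> \<in> lmeasurable" using assms by (simp add: lmeasurable_open)
    show "\<bar>infdist x (- \<Omega>) - infdist y (- \<Omega>)\<bar> \<le> norm (x - y)" for x y
      using infdist_triangle_abs[of x "- \<Omega>" y] by (simp add: dist_norm)
  qed simp
  show "x \<in> \<Omega> \<Longrightarrow> 0 < infdist x (- \<Omega>)"
    using assms(1) ne by (intro infdist_pos_not_in_closed) auto
qed

text \<open>In the Picone inequality the right-hand side stays bounded as \<open>d\<close> tends to zero. On pairs with
  $v(x)>0$ and $v(y)=0$ the remainder behaves like $u(y)^2 v(x)/d$, so such pairs form a null set. The sum of the two
  kernels is positive at all nonzero vectors, so a single pair of points compares any two parts of \<open>\<Omega>\<close>: if \<open>v\<close> is positive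
  on a set of positive measure, it vanishes almost nowhere in \<open>\<Omega>\<close>.\<close>

lemma strong_maximum_principle:
  fixes v b :: "'a::euclidean_space \<Rightarrow> real"
  assumes \<Omega>: "open \<Omega>" "bounded \<Omega>" and v: "v \<in> H_space \<Omega>" and v0: "\<And>x. 0 \<le> v x"
    and b: "b \<in> borel_measurable lebesgue" and B: "\<And>x. \<bar>b x\<bar> \<le> B"
    and weak: "\<And>\<phi>. \<phi> \<in> H_space \<Omega> \<Longrightarrow> EL_form v \<phi> = (LINT x|lebesgue. b x * (v x * \<phi> x))"
    and nontriv: "\<not> (AE x in lebesgue. v x = 0)"
  shows "AE x in lebesgue. x \<in> \<Omega> \<longrightarrow> 0 < v x"
proof -
  note [measurable] = H_spaceD(1)[OF v]
  have \<Omega>': "\<Omega> \<in> lmeasurable" using \<Omega> by (simp add: lmeasurable_open)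
  define u where "u x = infdist x (- \<Omega>)" for x
  have u: "u \<in> H_space \<Omega>" and upos: "\<And>x. x \<in> \<Omega> \<Longrightarrow> 0 < u x"
    unfolding u_def[abs_def] using infdist_Compl_in_H_space[OF \<Omega>] by auto
  obtain U where U: "\<And>x. \<bar>u x\<bar> \<le> U"
    unfolding u_def using infdist_Compl_in_H_space(2)[OF \<Omega>] by auto
  note [measurable] = H_spaceD(1)[OF u]
  define d :: "nat \<Rightarrow> real" where "d n = (1/2)^n" for n
  have d: "0 < d n" for n by (simp add: d_def)
  have d_lim: "d \<longlonglongrightarrow> 0" unfolding d_def[abs_def] by (rule tendsto_half_power)
  define K where "K p = k_kernel (fst p - snd p) + j_kernel (fst p - snd p)" for p :: "'a \<times> 'a"
  define R where "R n p = indicator \<Omega> (fst p) * indicator \<Omega> (snd p)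
      * picone_remainder (d n) u v (fst p) (snd p) * K p" for n p
  define C0 where "C0 = B + \<bar>rho_const DIM('a)\<bar> + c_const DIM('a) * measure lebesgue \<Omega>"
  let ?c = "c_const DIM('a)"
  have c: "0 < ?c" by (rule c_const_pos)
  have B0: "0 \<le> B" using B[of undefined] by linarith
  have C0: "0 \<le> C0" unfolding C0_def using B0 c by simp
  define C where "C = 2 / ?c * (EL_form u u - (LINT x|lebesgue. b x * (u x)\<^sup>2) + C0 * (LINT x|lebesgue. (u x)\<^sup>2))"
  have R_int: "integrable leb2 (R n)" for n
    unfolding R_def K_def by (rule picone_inequality(1)[OF \<Omega>' v v0 b B weak u U d])
  have R_nonneg: "0 \<le> R n p" for n p
    by (simp add: R_def K_def k_kernel_nonneg j_kernel_nonneg picone_remainder_nonneg v0 d)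
  have R_le: "(LINT p|leb2. R n p) \<le> C" for n
  proof -
    have "?c / 2 * (LINT p|leb2. R n p) \<le> EL_form u u - (LINT x|lebesgue. b x * (u x)\<^sup>2)
      + C0 * (LINT x|lebesgue. (u x)\<^sup>2 * (d n / (v x + d n)))"
      unfolding R_def K_def C0_def by (rule picone_inequality(2)[OF \<Omega>' v v0 b B weak u U d])
    also have "\<dots> \<le> EL_form u u - (LINT x|lebesgue. b x * (u x)\<^sup>2) + C0 * (LINT x|lebesgue. (u x)\<^sup>2)"
    proof (intro add_left_mono mult_left_mono C0 integral_mono_AE')
      show "AE x in lebesgue. (u x)\<^sup>2 * (d n / (v x + d n)) \<le> (u x)\<^sup>2"
        using d[of n] v0 by (intro AE_I2 mult_left_le) (auto simp: divide_le_eq add_nonneg_pos)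
    qed (use H_spaceD(2)[OF u] in auto)
    finally show ?thesis using c by (simp add: C_def field_simps)
  qed
  \<comment> \<open>The factor \<open>d n\<close> makes the integrals summable and is exactly the rate at which the remainder blows up at zeros of \<open>v\<close>.\<close>
  have "AE p in leb2. (\<lambda>n. d n * R n p) \<longlonglongrightarrow> 0"
  proof (rule AE_LIMSEQ_zero_of_geometric)
    show "integrable leb2 (\<lambda>p. d n * R n p)" for n using R_int by simp
    show "AE p in leb2. 0 \<le> d n * R n p" for n using R_nonneg d[of n] by simp
    show "(LINT p|leb2. d n * R n p) \<le> C * (1/2)^n" for n
      using mult_left_mono[OF R_le[of n], of "d n"] d[of n] by (simp add: d_def mult.commute)
  qed
  then have "AE p in leb2. \<not> (fst p \<in> \<Omega> \<and> 0 < v (fst p) \<and> snd p \<in> \<Omega> \<and> v (snd p) = 0)"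
  proof (eventually_elim, intro notI)
    fix p :: "'a \<times> 'a"
    assume lim: "(\<lambda>n. d n * R n p) \<longlonglongrightarrow> 0"
      and "fst p \<in> \<Omega> \<and> 0 < v (fst p) \<and> snd p \<in> \<Omega> \<and> v (snd p) = 0"
    then have p: "fst p \<in> \<Omega>" "0 < v (fst p)" "snd p \<in> \<Omega>" "v (snd p) = 0" by auto
    define r where "r n = K p * (u (fst p) * d n - u (snd p) * (v (fst p) + d n))\<^sup>2 / (v (fst p) + d n)" for n
    have "d n * R n p = r n" for n
      using p d[of n] by (simp add: R_def r_def picone_remainder_def)
    then have "r \<longlonglongrightarrow> 0" using lim by simp
    moreover have "r \<longlonglongrightarrow> K p * (u (fst p) * 0 - u (snd p) * (v (fst p) + 0))\<^sup>2 / (v (fst p) + 0)"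
      unfolding r_def using p by (intro tendsto_intros d_lim) auto
    ultimately have "K p * (u (fst p) * 0 - u (snd p) * (v (fst p) + 0))\<^sup>2 / (v (fst p) + 0) = 0"
      by (rule LIMSEQ_unique[symmetric])
    moreover have "0 < K p" unfolding K_def using p by (intro kernels_pos) auto
    moreover have "0 < u (snd p)" using p upos by simp
    ultimately show False using p by simp
  qed
  from leb_pair.AE_pair[OF this]
  \<comment> \<open>By Fubini, one point where \<open>v\<close> is positive already sees almost every zero of \<open>v\<close> in \<open>\<Omega>\<close>.\<close>
  have AE2: "AE x in lebesgue. AE y in lebesgue. \<not> (x \<in> \<Omega> \<and> 0 < v x \<and> y \<in> \<Omega> \<and> v y = 0)"
    by simp
  obtain x where x: "AE y in lebesgue. \<not> (x \<in> \<Omega> \<and> 0 < v x \<and> y \<in> \<Omega> \<and> v y = 0)" "v x \<noteq> 0"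
    using not_AE_obtain[OF AE2 nontriv] .
  have "x \<in> \<Omega>" using H_spaceD(3)[OF v] x(2) by blast
  moreover have "0 < v x" using v0[of x] x(2) by simp
  ultimately show ?thesis
    using x(1) by (auto elim!: eventually_mono simp: less_le v0 not_less)
qed

section \<open>Bounded almost minimizers\<close>

definition truncation :: "real \<Rightarrow> real \<Rightarrow> real" where
  "truncation M t = max (- M) (min M t)"

lemma H_space_truncation:
  assumes u: "u \<in> H_space \<Omega>" "0 \<le> M" shows "(\<lambda>x. truncation M (u x)) \<in> H_space \<Omega>"
  by (rule H_space_comparison[OF u(1) u(1), where A = 1])
    (use H_spaceD(1)[OF u(1)] u(2) in \<open>auto simp: truncation_def max_def min_def\<close>)

lemma truncation_le: "0 \<le> M \<Longrightarrow> \<bar>truncation M t\<bar> \<le> \<bar>t\<bar>" "0 \<le> M \<Longrightarrow> \<bar>truncation M t\<bar> \<le> M"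
  "0 \<le> M \<Longrightarrow> \<bar>truncation M s - truncation M t\<bar> \<le> \<bar>s - t\<bar>"
  by (auto simp: truncation_def max_def min_def)

lemma truncation_tendsto: "(\<lambda>n. truncation (real n) t) \<longlonglongrightarrow> t"
proof (rule tendsto_eventually)
  obtain N :: nat where "\<bar>t\<bar> \<le> real N" using real_arch_simple by blast
  then have "truncation (real n) t = t" if "N \<le> n" for n
    using that by (auto simp: truncation_def max_def min_def)
  then show "\<forall>\<^sub>F n in sequentially. truncation (real n) t = t"
    by (auto simp: eventually_sequentially)
qed

lemma truncation_form_tendsto:
  fixes w :: "'a::euclidean_space \<Rightarrow> real"
  assumes \<Omega>: "\<Omega> \<in> lmeasurable" and w: "w \<in> H_space \<Omega>"
  defines "w' \<equiv> \<lambda>n x. truncation (real n) (w x)"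
  shows "(\<lambda>n. LINT x|lebesgue. (w' n x)\<^sup>2) \<longlonglongrightarrow> (LINT x|lebesgue. (w x)\<^sup>2)"
    and "(\<lambda>n. EL_form (w' n) (w' n)) \<longlonglongrightarrow> EL_form w w"
proof -
  have w': "w' n \<in> H_space \<Omega>" for n unfolding w'_def by (rule H_space_truncation[OF w]) simp
  note [measurable] = H_spaceD(1)[OF w] H_spaceD(1)[OF w']
  have lim: "(\<lambda>n. w' n x) \<longlonglongrightarrow> w x" for x unfolding w'_def by (rule truncation_tendsto)
  have abs: "\<bar>w' n x\<bar> \<le> \<bar>w x\<bar>" for n x unfolding w'_def by (rule truncation_le) simp
  have diff: "\<bar>w' n x - w' n y\<bar> \<le> \<bar>w x - w y\<bar>" for n x y unfolding w'_def by (rule truncation_le) simp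
  have 1: "(\<lambda>n. LINT x|lebesgue. w' n x * w' n x) \<longlonglongrightarrow> (LINT x|lebesgue. w x * w x)"
  proof (rule integral_dominated_convergence)
    show "integrable lebesgue (\<lambda>x. w x * w x)"
      using H_spaceD(2)[OF w] by (simp add: power2_eq_square)
    show "AE x in lebesgue. (\<lambda>n. w' n x * w' n x) \<longlonglongrightarrow> w x * w x"
      using lim by (intro AE_I2 tendsto_mult)
    show "AE x in lebesgue. norm (w' n x * w' n x) \<le> w x * w x" for n
      using abs[of n] by (intro AE_I2) (simp add: abs_mult flip: abs_le_square_iff power2_eq_square)
  qed measurable
  then show "(\<lambda>n. LINT x|lebesgue. (w' n x)\<^sup>2) \<longlonglongrightarrow> (LINT x|lebesgue. (w x)\<^sup>2)"
    by (simp add: power2_eq_square)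
  have 2: "(\<lambda>n. LINT p|leb2. (w' n (fst p) - w' n (snd p)) * (w' n (fst p) - w' n (snd p)) * k_kernel (fst p - snd p))
    \<longlonglongrightarrow> (LINT p|leb2. (w (fst p) - w (snd p)) * (w (fst p) - w (snd p)) * k_kernel (fst p - snd p))"
  proof (rule integral_dominated_convergence)
    show "integrable leb2 (\<lambda>p. (w (fst p) - w (snd p)) * (w (fst p) - w (snd p)) * k_kernel (fst p - snd p))"
      by (rule H_space_integrable_form[OF w w])
    show "AE p in leb2. (\<lambda>n. (w' n (fst p) - w' n (snd p)) * (w' n (fst p) - w' n (snd p)) * k_kernel (fst p - snd p))
      \<longlonglongrightarrow> (w (fst p) - w (snd p)) * (w (fst p) - w (snd p)) * k_kernel (fst p - snd p)"
      by (intro AE_I2 tendsto_intros lim)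
    show "AE p in leb2. norm ((w' n (fst p) - w' n (snd p)) * (w' n (fst p) - w' n (snd p)) * k_kernel (fst p - snd p))
      \<le> (w (fst p) - w (snd p)) * (w (fst p) - w (snd p)) * k_kernel (fst p - snd p)" for n
      using diff[of n]
      by (intro AE_I2)
        (simp add: k_kernel_nonneg mult_right_mono flip: power2_eq_square abs_le_square_iff)
  qed measurable
  have 3: "(\<lambda>n. LINT p|leb2. w' n (fst p) * w' n (snd p) * j_kernel (fst p - snd p))
    \<longlonglongrightarrow> (LINT p|leb2. w (fst p) * w (snd p) * j_kernel (fst p - snd p))"
  proof (rule integral_dominated_convergence)
    show "integrable leb2 (\<lambda>p. \<bar>w (fst p)\<bar> * \<bar>w (snd p)\<bar> * j_kernel (fst p - snd p))"
      using H_space_integrable[OF \<Omega> w] by (intro integrable_j_form) auto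
    show "AE p in leb2. (\<lambda>n. w' n (fst p) * w' n (snd p) * j_kernel (fst p - snd p))
      \<longlonglongrightarrow> w (fst p) * w (snd p) * j_kernel (fst p - snd p)"
      by (intro AE_I2 tendsto_intros lim)
    show "AE p in leb2. norm (w' n (fst p) * w' n (snd p) * j_kernel (fst p - snd p))
      \<le> \<bar>w (fst p)\<bar> * \<bar>w (snd p)\<bar> * j_kernel (fst p - snd p)" for n
      using mult_mono[OF abs abs]
      by (intro AE_I2) (simp add: abs_mult j_kernel_nonneg mult_right_mono)
  qed measurable
  show "(\<lambda>n. EL_form (w' n) (w' n)) \<longlonglongrightarrow> EL_form w w"
    unfolding EL_form_alt by (intro tendsto_intros 1 2 3)
qed

text \<open>The Picone inequality needs bounded functions. Truncation at large levels changes the form and the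
  norm arbitrarily little, so the infimum is approached by bounded functions. They are no longer normalised exactly,
  but their norm stays bounded away from zero.\<close>

lemma bounded_almost_minimizer:
  fixes \<Omega> :: "'a::euclidean_space set"
  assumes \<Omega>: "\<Omega> \<in> lmeasurable" and v: "v \<in> H_space \<Omega>"
    and nontriv: "\<not> (AE x in lebesgue. v x = 0)" and e: "0 < e"
  obtains u U where "u \<in> H_space \<Omega>" "\<And>x. \<bar>u x\<bar> \<le> U"
    "1/2 \<le> (LINT x|lebesgue. (u x)\<^sup>2)" "(LINT x|lebesgue. (u x)\<^sup>2) \<le> 1"
    "EL_form u u - first_eigenvalue \<Omega> * (LINT x|lebesgue. (u x)\<^sup>2) < e"
proof -
  have norm_eq: "(LINT x|lebesgue_on \<Omega>. (u x)\<^sup>2) = (LINT x|lebesgue. (u x)\<^sup>2)" if "u \<in> H_space \<Omega>" for u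
  proof -
    have "(LINT x|lebesgue_on \<Omega>. (u x)\<^sup>2) = (LINT x|lebesgue. indicator \<Omega> x *\<^sub>R (u x)\<^sup>2)"
      using \<Omega> by (intro integral_restrict_space) auto
    also have "\<dots> = (LINT x|lebesgue. (u x)\<^sup>2)"
      using H_spaceD(3)[OF that] by (intro Bochner_Integration.integral_cong) (auto simp: indicator_def)
    finally show ?thesis .
  qed
  define X where "X = {EL_form u u | u. u \<in> H_space \<Omega> \<and> sqrt (LINT x | lebesgue_on \<Omega>. (u x)\<^sup>2) = 1}"
  define I where "I = (LINT x|lebesgue. (v x)\<^sup>2)"
  have "I \<noteq> 0"
    using nontriv integral_nonneg_eq_0_iff_AE[OF H_spaceD(2)[OF v]] by (auto simp: I_def)
  moreover have "0 \<le> I" by (simp add: I_def)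
  ultimately have I: "0 < I" by simp
  define w0 where "w0 x = (1 / sqrt I) * v x" for x
  have w0: "w0 \<in> H_space \<Omega>" unfolding w0_def[abs_def] by (rule H_space_cmult[OF v])
  have "(LINT x|lebesgue. (w0 x)\<^sup>2) = 1"
    using I by (simp add: w0_def power_mult_distrib power_divide I_def[symmetric])
  then have "EL_form w0 w0 \<in> X" unfolding X_def using w0 norm_eq[OF w0] by auto
  then have "X \<noteq> {}" by blast
  moreover have "Inf X < first_eigenvalue \<Omega> + e" unfolding X_def first_eigenvalue_def using e by simp
  \<comment> \<open>A real number above the infimum of a nonempty set is above some element, even if the set is not bounded below.\<close>
  ultimately have "\<exists>x\<in>X. x < first_eigenvalue \<Omega> + e" by (rule cInf_lessD)
  then obtain w where w: "w \<in> H_space \<Omega>" "sqrt (LINT x | lebesgue_on \<Omega>. (w x)\<^sup>2) = 1"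
    and EL: "EL_form w w < first_eigenvalue \<Omega> + e"
    by (auto simp: X_def)
  have w1: "(LINT x|lebesgue. (w x)\<^sup>2) = 1" using w norm_eq[OF w(1)] by simp
  define w' where "w' n x = truncation (real n) (w x)" for n x
  have w': "w' n \<in> H_space \<Omega>" for n unfolding w'_def[abs_def] by (rule H_space_truncation[OF w(1)]) simp
  have lim1: "(\<lambda>n. LINT x|lebesgue. (w' n x)\<^sup>2) \<longlonglongrightarrow> 1"
    using truncation_form_tendsto(1)[OF \<Omega> w(1)] by (simp add: w'_def w1)
  have lim2: "(\<lambda>n. EL_form (w' n) (w' n)) \<longlonglongrightarrow> EL_form w w"
    unfolding w'_def[abs_def] by (rule truncation_form_tendsto(2)[OF \<Omega> w(1)])
  have "(\<lambda>n. EL_form (w' n) (w' n) - first_eigenvalue \<Omega> * (LINT x|lebesgue. (w' n x)\<^sup>2))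
    \<longlonglongrightarrow> EL_form w w - first_eigenvalue \<Omega> * 1"
    by (intro tendsto_intros lim1 lim2)
  then have "\<forall>\<^sub>F n in sequentially. EL_form (w' n) (w' n) - first_eigenvalue \<Omega> * (LINT x|lebesgue. (w' n x)\<^sup>2) < e"
    by (rule order_tendstoD(2)) (use EL in simp)
  moreover have "\<forall>\<^sub>F n in sequentially. 1/2 < (LINT x|lebesgue. (w' n x)\<^sup>2)"
    by (rule order_tendstoD(1)[OF lim1]) simp
  ultimately have "\<forall>\<^sub>F n in sequentially. EL_form (w' n) (w' n) - first_eigenvalue \<Omega> * (LINT x|lebesgue. (w' n x)\<^sup>2) < e
    \<and> 1/2 < (LINT x|lebesgue. (w' n x)\<^sup>2)" by (rule eventually_conj)
  then obtain n where n: "EL_form (w' n) (w' n) - first_eigenvalue \<Omega> * (LINT x|lebesgue. (w' n x)\<^sup>2) < e"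
    "1/2 < (LINT x|lebesgue. (w' n x)\<^sup>2)"
    using eventually_happens'[OF sequentially_bot] by blast
  show ?thesis
  proof (rule that[OF w'[of n], of "real n"])
    show "\<bar>w' n x\<bar> \<le> real n" for x unfolding w'_def by (rule truncation_le) simp
    have "(LINT x|lebesgue. (w' n x)\<^sup>2) \<le> (LINT x|lebesgue. (w x)\<^sup>2)"
      using truncation_le(1)[of "real n"] unfolding w'_def[abs_def]
      by (intro integral_mono H_spaceD(2)[OF w(1)] H_spaceD(2)[OF w', unfolded w'_def[abs_def]])
        (simp flip: abs_le_square_iff)
    then show "(LINT x|lebesgue. (w' n x)\<^sup>2) \<le> 1" by (simp add: w1)
  qed (use n in auto)
qed

section \<open>Almost minimizers do not vanish in the limit\<close>

text \<open>The truncations $\min(|u_n|, M)$ tend to zero in $L^1$ by dominated convergence, as \<open>\<Omega>\<close> has finite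
  measure, and the part above \<open>M\<close> is at most $u_n^2/M$.\<close>

lemma L1_tendsto_zero_of_L2_bounded:
  fixes u :: "nat \<Rightarrow> 'a::euclidean_space \<Rightarrow> real"
  assumes \<Omega>: "\<Omega> \<in> lmeasurable" and u: "\<And>n. u n \<in> H_space \<Omega>"
    and norm: "\<And>n. (LINT x|lebesgue. (u n x)\<^sup>2) \<le> 1"
    and lim: "AE x in lebesgue. (\<lambda>n. u n x) \<longlonglongrightarrow> 0"
  shows "(\<lambda>n. LINT x|lebesgue. \<bar>u n x\<bar>) \<longlonglongrightarrow> 0"
proof (rule order_tendstoI)
  fix a :: real assume "a < 0"
  then show "\<forall>\<^sub>F n in sequentially. a < (LINT x|lebesgue. \<bar>u n x\<bar>)"
    by (intro always_eventually allI, elim less_le_trans) simp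
next
  fix e :: real assume e: "0 < e"
  note [measurable] = H_spaceD(1)[OF u]
  \<comment> \<open>This level makes the contribution above it at most half of \<open>e\<close>, because the $L^2$ norms are at most 1.\<close>
  define M where "M = 2 / e"
  have M: "0 < M" using e by (simp add: M_def)
  have "(\<lambda>n. LINT x|lebesgue. min \<bar>u n x\<bar> M) \<longlonglongrightarrow> (LINT x|(lebesgue :: 'a measure). 0)"
  proof (rule integral_dominated_convergence)
    show "integrable lebesgue (\<lambda>x. M * indicator \<Omega> x)"
      using \<Omega> by (auto simp: fmeasurable_def)
    show "AE x in lebesgue. (\<lambda>n. min \<bar>u n x\<bar> M) \<longlonglongrightarrow> 0"
      using lim
    proof eventually_elim
      case (elim x)
      from tendsto_min[OF tendsto_rabs[OF elim] tendsto_const[of M]] M show ?case by simp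
    qed
    show "AE x in lebesgue. norm (min \<bar>u n x\<bar> M) \<le> M * indicator \<Omega> x" for n
      using H_spaceD(3)[OF u] M by (intro AE_I2) (auto simp: indicator_def)
  qed measurable
  then have "\<forall>\<^sub>F n in sequentially. (LINT x|lebesgue. min \<bar>u n x\<bar> M) < e / 2"
    using e by (intro order_tendstoD) auto
  then show "\<forall>\<^sub>F n in sequentially. (LINT x|lebesgue. \<bar>u n x\<bar>) < e"
  proof eventually_elim
    case (elim n)
    have i: "integrable lebesgue (\<lambda>x. \<bar>u n x\<bar>)" using H_space_integrable[OF \<Omega> u] by simp
    have imin: "integrable lebesgue (\<lambda>x. min \<bar>u n x\<bar> M)"
      using M by (intro Bochner_Integration.integrable_bound[OF i]) auto
    have le: "t \<le> min t M + t\<^sup>2 / M" if "0 \<le> t" for t :: real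
    proof (cases "t \<le> M")
      case False
      then have "M * t \<le> t * t" using that by (intro mult_right_mono) auto
      then have "t \<le> t\<^sup>2 / M" using M by (simp add: field_simps power2_eq_square)
      with False M show ?thesis by simp
    qed (use M in simp)
    have "(LINT x|lebesgue. \<bar>u n x\<bar>) \<le> (LINT x|lebesgue. min \<bar>u n x\<bar> M + (u n x)\<^sup>2 / M)"
      using le[OF abs_ge_zero] i imin H_spaceD(2)[OF u] by (intro integral_mono) auto
    also have "\<dots> = (LINT x|lebesgue. min \<bar>u n x\<bar> M) + (LINT x|lebesgue. (u n x)\<^sup>2) / M"
      using imin H_spaceD(2)[OF u] by simp
    also have "\<dots> < e / 2 + 1 / M"
      using elim norm[of n] M by (intro add_less_le_mono divide_right_mono) auto
    finally show ?case by (simp add: M_def)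
  qed
qed

text \<open>If the functions tended to zero almost everywhere, they would do so in $L^1$. The coercivity estimate
  would then bound an arbitrarily large multiple of $\|u_n\|_2^2 \geq 1/2$ by the energies, which are bounded.\<close>

lemma no_vanishing_almost_minimizers:
  fixes u :: "nat \<Rightarrow> 'a::euclidean_space \<Rightarrow> real"
  assumes \<Omega>: "\<Omega> \<in> lmeasurable" and u: "\<And>n. u n \<in> H_space \<Omega>"
    and lower: "\<And>n. 1/2 \<le> (LINT x|lebesgue. (u n x)\<^sup>2)"
    and upper: "\<And>n. (LINT x|lebesgue. (u n x)\<^sup>2) \<le> 1"
    and EL: "\<And>n. EL_form (u n) (u n) \<le> A"
  shows "\<not> (AE x in lebesgue. (\<lambda>n. u n x) \<longlonglongrightarrow> 0)"
proof
  assume "AE x in lebesgue. (\<lambda>n. u n x) \<longlonglongrightarrow> 0"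
  with L1_tendsto_zero_of_L2_bounded[OF \<Omega> u upper]
  have L1: "(\<lambda>n. LINT x|lebesgue. \<bar>u n x\<bar>) \<longlonglongrightarrow> 0" .
  let ?c = "c_const DIM('a)" and ?\<rho> = "rho_const DIM('a)" and ?m = "shell_mass DIM('a)"
  have c: "0 < ?c" by (rule c_const_pos)
  have m: "0 < ?m" by (rule shell_mass_pos)
  have *: "?c * (real N * ?m / 2) \<le> A + \<bar>?\<rho>\<bar>" for N :: nat
  proof -
    let ?K = "2 ^ (N * DIM('a)) :: real"
    have le: "?c * (real N * ?m / 2) \<le> A + \<bar>?\<rho>\<bar> + (?c + ?c * ?K) * (LINT x|lebesgue. \<bar>u n x\<bar>)\<^sup>2" for n
    proof -
      let ?I = "LINT p|leb2. (u n (fst p) - u n (snd p)) * (u n (fst p) - u n (snd p)) * k_kernel (fst p - snd p)"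
      let ?J = "LINT p|leb2. u n (fst p) * u n (snd p) * j_kernel (fst p - snd p)"
      let ?l = "LINT x|lebesgue. \<bar>u n x\<bar>" and ?q = "LINT x|lebesgue. (u n x)\<^sup>2"
      have "real N * ?m * (1/2) \<le> real N * ?m * ?q"
        using lower[of n] m by (intro mult_left_mono) auto
      moreover have "real N * ?m * ?q - ?K * ?l\<^sup>2 \<le> 1 / 2 * ?I"
        using dyadic_coercivity[OF H_space_integrable[OF \<Omega> u] H_spaceD(2)[OF u] H_spaceD(4)[OF u], of N]
        by (simp add: split_beta' power2_eq_square)
      ultimately have "real N * ?m / 2 \<le> 1 / 2 * ?I + ?K * ?l\<^sup>2" by simp
      then have "?c * (real N * ?m / 2) \<le> ?c * (1 / 2 * ?I + ?K * ?l\<^sup>2)"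
        using c by (intro mult_left_mono) auto
      also have "\<dots> = EL_form (u n) (u n) + ?c * ?J - ?\<rho> * ?q + ?c * ?K * ?l\<^sup>2"
        unfolding EL_form_alt by (simp add: algebra_simps power2_eq_square)
      also have "\<dots> \<le> A + ?c * ?l\<^sup>2 + \<bar>?\<rho>\<bar> + ?c * ?K * ?l\<^sup>2"
      proof -
        have "?c * ?J \<le> ?c * ?l\<^sup>2"
          using integrable_j_form(2)[OF H_space_integrable[OF \<Omega> u] H_space_integrable[OF \<Omega> u], of n n] c
          unfolding power2_eq_square by (intro mult_left_mono) auto
        moreover have "- ?\<rho> * ?q \<le> \<bar>?\<rho>\<bar> * 1"
          using upper[of n] lower[of n] by (intro mult_mono) auto
        ultimately show ?thesis using EL[of n] by simp
      qed
      finally show ?thesis by (simp add: algebra_simps)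
    qed
    have "(\<lambda>n. A + \<bar>?\<rho>\<bar> + (?c + ?c * ?K) * (LINT x|lebesgue. \<bar>u n x\<bar>)\<^sup>2)
        \<longlonglongrightarrow> A + \<bar>?\<rho>\<bar> + (?c + ?c * ?K) * 0\<^sup>2"
      by (intro tendsto_intros L1)
    then have "?c * (real N * ?m / 2) \<le> A + \<bar>?\<rho>\<bar> + (?c + ?c * ?K) * 0\<^sup>2"
      by (rule tendsto_lowerbound) (use le in auto)
    then show ?thesis by simp
  qed
  obtain N :: nat where "(A + \<bar>?\<rho>\<bar>) / (?c * ?m / 2) < real N"
    using reals_Archimedean2 by blast
  then have "A + \<bar>?\<rho>\<bar> < ?c * (real N * ?m / 2)"
    using c m by (simp add: field_simps)
  with *[of N] show False by simp
qed

section \<open>Nonexistence of solutions of one sign\<close>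

lemma integral_quotient_tendsto_zero:
  fixes u v :: "'a::euclidean_space \<Rightarrow> real"
  assumes u: "u \<in> H_space \<Omega>" and [measurable]: "v \<in> borel_measurable lebesgue"
    and v0: "\<And>x. 0 \<le> v x" and pos: "AE x in lebesgue. x \<in> \<Omega> \<longrightarrow> 0 < v x"
  shows "(\<lambda>n. LINT x|lebesgue. (u x)\<^sup>2 * ((1/2)^n / (v x + (1/2)^n))) \<longlonglongrightarrow> 0"
proof -
  note [measurable] = H_spaceD(1)[OF u]
  have "(\<lambda>n. LINT x|lebesgue. (u x)\<^sup>2 * ((1/2)^n / (v x + (1/2)^n))) \<longlonglongrightarrow> (LINT x|(lebesgue::'a measure). 0)"
  proof (rule integral_dominated_convergence)
    show "integrable lebesgue (\<lambda>x. (u x)\<^sup>2)" by (rule H_spaceD[OF u])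
    show "AE x in lebesgue. (\<lambda>n. (u x)\<^sup>2 * ((1/2)^n / (v x + (1/2)^n))) \<longlonglongrightarrow> 0"
      using pos
    proof eventually_elim
      case (elim x)
      show ?case
      proof (cases "x \<in> \<Omega>")
        case True
        with elim have "(\<lambda>n. (u x)\<^sup>2 * ((1/2)^n / (v x + (1/2)^n))) \<longlonglongrightarrow> (u x)\<^sup>2 * (0 / (v x + 0))"
          by (intro tendsto_intros tendsto_half_power) auto
        then show ?thesis by simp
      qed (use H_spaceD(3)[OF u] in simp)
    qed
    show "AE x in lebesgue. norm ((u x)\<^sup>2 * ((1/2)^n / (v x + (1/2)^n))) \<le> (u x)\<^sup>2" for n
    proof (intro AE_I2)
      fix x
      have "0 < v x + (1/2)^n" using v0[of x] by (simp add: add_nonneg_pos)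
      then have "0 \<le> (1/2)^n / (v x + (1/2)^n)" "(1/2)^n / (v x + (1/2)^n) \<le> 1"
        using v0[of x] by (auto simp: divide_le_eq)
      then show "norm ((u x)\<^sup>2 * ((1/2)^n / (v x + (1/2)^n))) \<le> (u x)\<^sup>2"
        using mult_left_le[of "(1/2)^n / (v x + (1/2)^n)" "(u x)\<^sup>2"]
        unfolding real_norm_def abs_mult by (simp only: abs_of_nonneg zero_le_power2)
    qed
  qed measurable
  then show ?thesis by simp
qed

lemma tendsto_zero_of_square:
  fixes f :: "'b \<Rightarrow> real"
  assumes "((\<lambda>n. (f n)\<^sup>2) \<longlongrightarrow> 0) F" shows "(f \<longlongrightarrow> 0) F"
  using tendsto_real_sqrt[OF assms] by (simp add: tendsto_rabs_zero_iff)

text \<open>The remainder measures the difference of the quotients $u_n/(v+d_n)$ at two points. If it tends to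
  zero, smallness of $u_n$ propagates from one point to the other.\<close>

lemma tendsto_zero_of_picone_remainder:
  fixes u :: "nat \<Rightarrow> 'a \<Rightarrow> real"
  assumes d: "d \<longlonglongrightarrow> 0" "\<And>n. 0 < d n" and v: "0 < v x" "0 < v y" and K: "0 < K"
    and R: "(\<lambda>n. picone_remainder (d n) (u n) v x y * K) \<longlonglongrightarrow> 0"
    and ux: "(\<lambda>n. u n x) \<longlonglongrightarrow> 0"
  shows "(\<lambda>n. u n y) \<longlonglongrightarrow> 0"
proof -
  define X Y where "X n = v x + d n" and "Y n = v y + d n" for n
  have lim: "X \<longlonglongrightarrow> v x + 0" "Y \<longlonglongrightarrow> v y + 0"
    unfolding X_def Y_def by (intro tendsto_intros d)+
  have pos: "0 < X n" "0 < Y n" for n using v d(2)[of n] by (auto simp: X_def Y_def)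
  have "(\<lambda>n. picone_remainder (d n) (u n) v x y * K * (X n * Y n) / K) \<longlonglongrightarrow> 0 * ((v x + 0) * (v y + 0)) / K"
    using K by (intro tendsto_intros R lim) auto
  moreover have "picone_remainder (d n) (u n) v x y * K * (X n * Y n) / K = (u n x * Y n - u n y * X n)\<^sup>2" for n
    using K pos[of n] by (simp add: picone_remainder_def X_def[symmetric] Y_def[symmetric])
  ultimately have "(\<lambda>n. (u n x * Y n - u n y * X n)\<^sup>2) \<longlonglongrightarrow> 0" by simp
  then have "(\<lambda>n. u n x * Y n - u n y * X n) \<longlonglongrightarrow> 0"
    by (rule tendsto_zero_of_square)
  then have "(\<lambda>n. (u n x * Y n - (u n x * Y n - u n y * X n)) / X n) \<longlonglongrightarrow> (0 * (v y + 0) - 0) / (v x + 0)"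
    using v by (intro tendsto_intros ux lim) auto
  moreover have "(u n x * Y n - (u n x * Y n - u n y * X n)) / X n = u n y" for n
    using pos[of n] by simp
  ultimately show ?thesis by simp
qed

text \<open>Suppose \<open>b\<close> exceeds the first eigenvalue $\mu$ on a set of positive measure. For bounded almost
  minimizers $u_n$ and suitable $d_n$ the Picone inequality bounds
  $\frac{c_N}{2}\iint R_n + \int (b-\mu)u_n^2$ by a null sequence, and both terms are nonnegative. The second term gives
  $u_n \to 0$ where $b>\mu$, the first one spreads this to almost all of \<open>\<Omega>\<close>, and this contradicts
  \<open>no_vanishing_almost_minimizers\<close>.\<close>

lemma no_nonnegative_solution:
  fixes v b :: "'a::euclidean_space \<Rightarrow> real"
  assumes \<Omega>: "open \<Omega>" "bounded \<Omega>" and v: "v \<in> H_space \<Omega>" and v0: "\<And>x. 0 \<le> v x"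
    and b: "b \<in> borel_measurable lebesgue" and B: "\<And>x. \<bar>b x\<bar> \<le> B"
    and weak: "\<And>\<phi>. \<phi> \<in> H_space \<Omega> \<Longrightarrow> EL_form v \<phi> = (LINT x|lebesgue. b x * (v x * \<phi> x))"
    and nontriv: "\<not> (AE x in lebesgue. v x = 0)"
    and ge: "AE x in lebesgue. x \<in> \<Omega> \<longrightarrow> first_eigenvalue \<Omega> \<le> b x"
  shows "AE x in lebesgue. x \<in> \<Omega> \<longrightarrow> b x \<le> first_eigenvalue \<Omega>"
proof (rule ccontr)
  assume gt: "\<not> ?thesis"
  note [measurable] = H_spaceD(1)[OF v] b
  have \<Omega>': "\<Omega> \<in> lmeasurable" using \<Omega> by (simp add: lmeasurable_open)
  define \<mu> where "\<mu> = first_eigenvalue \<Omega>"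
  have vpos: "AE x in lebesgue. x \<in> \<Omega> \<longrightarrow> 0 < v x"
    by (rule strong_maximum_principle[OF \<Omega> v v0 b B weak nontriv])
  let ?c = "c_const DIM('a)"
  have c: "0 < ?c" by (rule c_const_pos)
  define C0 where "C0 = B + \<bar>rho_const DIM('a)\<bar> + c_const DIM('a) * measure lebesgue \<Omega>"
  define K where "K p = k_kernel (fst p - snd p) + j_kernel (fst p - snd p)" for p :: "'a \<times> 'a"
  \<comment> \<open>The number \<open>d\<close> is chosen after \<open>u\<close>, so that the error term of the Picone inequality is as small as the defect of minimality.\<close>
  define almost_min where "almost_min n u U d \<longleftrightarrow> u \<in> H_space \<Omega> \<and> (\<forall>x. \<bar>u x\<bar> \<le> U) \<and> 1/2 \<le> (LINT x|lebesgue. (u x)\<^sup>2)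
      \<and> (LINT x|lebesgue. (u x)\<^sup>2) \<le> 1 \<and> EL_form u u - \<mu> * (LINT x|lebesgue. (u x)\<^sup>2) < (1/2)^n
      \<and> 0 < d \<and> d \<le> (1/2)^n \<and> C0 * (LINT x|lebesgue. (u x)\<^sup>2 * (d / (v x + d))) \<le> (1/2)^n" for n u U d
  have "\<exists>u U d. almost_min n u U d" for n
  proof -
    obtain u U where u: "u \<in> H_space \<Omega>" "\<And>x. \<bar>u x\<bar> \<le> U"
      "1/2 \<le> (LINT x|lebesgue. (u x)\<^sup>2)" "(LINT x|lebesgue. (u x)\<^sup>2) \<le> 1"
      "EL_form u u - \<mu> * (LINT x|lebesgue. (u x)\<^sup>2) < (1/2)^n"
      unfolding \<mu>_def by (rule bounded_almost_minimizer[OF \<Omega>' v nontriv, of "(1/2)^n"]) auto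
    have "(\<lambda>m. C0 * (LINT x|lebesgue. (u x)\<^sup>2 * ((1/2)^m / (v x + (1/2)^m)))) \<longlonglongrightarrow> C0 * 0"
      by (intro tendsto_intros integral_quotient_tendsto_zero[OF u(1) _ v0 vpos]) auto
    then have "\<forall>\<^sub>F m in sequentially. C0 * (LINT x|lebesgue. (u x)\<^sup>2 * ((1/2)^m / (v x + (1/2)^m))) < (1/2)^n"
      by (rule order_tendstoD) simp
    moreover have "\<forall>\<^sub>F m in sequentially. n \<le> m" by (rule eventually_ge_at_top)
    ultimately have "\<forall>\<^sub>F m in sequentially. C0 * (LINT x|lebesgue. (u x)\<^sup>2 * ((1/2)^m / (v x + (1/2)^m))) < (1/2)^n \<and> n \<le> m"
      by (rule eventually_conj)
    then obtain m where m: "C0 * (LINT x|lebesgue. (u x)\<^sup>2 * ((1/2)^m / (v x + (1/2)^m))) < (1/2)^n" "n \<le> m"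
      using eventually_happens'[OF sequentially_bot] by blast
    show ?thesis
      unfolding almost_min_def using u m by (intro exI[of _ u] exI[of _ U] exI[of _ "(1/2)^m"]) (auto intro: power_decreasing)
  qed
  then obtain u U d where am: "\<And>n. almost_min n (u n) (U n) (d n)" by metis
  have u: "\<And>n. u n \<in> H_space \<Omega>" and U: "\<And>n x. \<bar>u n x\<bar> \<le> U n"
    and lower: "\<And>n. 1/2 \<le> (LINT x|lebesgue. (u n x)\<^sup>2)" and upper: "\<And>n. (LINT x|lebesgue. (u n x)\<^sup>2) \<le> 1"
    and EL: "\<And>n. EL_form (u n) (u n) - \<mu> * (LINT x|lebesgue. (u n x)\<^sup>2) < (1/2)^n"
    and d: "\<And>n. 0 < d n" "\<And>n. d n \<le> (1/2)^n"
    and err: "\<And>n. C0 * (LINT x|lebesgue. (u n x)\<^sup>2 * (d n / (v x + d n))) \<le> (1/2)^n"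
    using am unfolding almost_min_def by blast+
  note [measurable] = H_spaceD(1)[OF u]
  have d_lim: "d \<longlonglongrightarrow> 0"
    by (rule tendsto_sandwich[OF _ _ tendsto_const tendsto_half_power]) (simp_all add: d less_imp_le[OF d(1)])
  define R where "R n p = indicator \<Omega> (fst p) * indicator \<Omega> (snd p)
      * picone_remainder (d n) (u n) v (fst p) (snd p) * K p" for n p
  define Q where "Q n x = (b x - \<mu>) * (u n x)\<^sup>2" for n x
  have R_int: "integrable leb2 (R n)" for n
    unfolding R_def K_def by (rule picone_inequality(1)[OF \<Omega>' v v0 b B weak u U d(1)])
  have R_nonneg: "0 \<le> R n p" for n p
    by (simp add: R_def K_def k_kernel_nonneg j_kernel_nonneg picone_remainder_nonneg v0 d)
  have bu_int: "integrable lebesgue (\<lambda>x. b x * (u n x)\<^sup>2)" for n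
    using H_space_integrable_times[OF u u b B] by (simp add: power2_eq_square)
  have Q_int: "integrable lebesgue (Q n)" for n
    unfolding Q_def left_diff_distrib using bu_int H_spaceD(2)[OF u] by simp
  have Q_nonneg: "AE x in lebesgue. 0 \<le> Q n x" for n
    using ge
  proof eventually_elim
    case (elim x)
    then show ?case using H_spaceD(3)[OF u, of x n] by (cases "x \<in> \<Omega>") (auto simp: Q_def \<mu>_def)
  qed
  have sum_le: "?c / 2 * (LINT p|leb2. R n p) + (LINT x|lebesgue. Q n x) \<le> 2 * (1/2)^n" for n
  proof -
    have "?c / 2 * (LINT p|leb2. R n p) \<le> EL_form (u n) (u n) - (LINT x|lebesgue. b x * (u n x)\<^sup>2)
      + C0 * (LINT x|lebesgue. (u n x)\<^sup>2 * (d n / (v x + d n)))"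
      unfolding R_def K_def C0_def by (rule picone_inequality(2)[OF \<Omega>' v v0 b B weak u U d(1)])
    moreover have "(LINT x|lebesgue. Q n x) = (LINT x|lebesgue. b x * (u n x)\<^sup>2) - \<mu> * (LINT x|lebesgue. (u n x)\<^sup>2)"
      unfolding Q_def left_diff_distrib using bu_int H_spaceD(2)[OF u] by simp
    ultimately show ?thesis using EL[of n] err[of n] by linarith
  qed
  have IR: "0 \<le> ?c / 2 * (LINT p|leb2. R n p)" and IQ: "0 \<le> (LINT x|lebesgue. Q n x)" for n
    using R_nonneg Q_nonneg c by (auto intro!: mult_nonneg_nonneg integral_nonneg_AE)
  have R_lim: "AE p in leb2. (\<lambda>n. R n p) \<longlonglongrightarrow> 0"
  proof (rule AE_LIMSEQ_zero_of_geometric[OF R_int])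
    show "(LINT p|leb2. R n p) \<le> 4 / ?c * (1/2)^n" for n
    proof -
      have "?c / 2 * (LINT p|leb2. R n p) \<le> 2 * (1/2)^n" using sum_le[of n] IQ[of n] by linarith
      then show ?thesis using c by (simp add: field_simps)
    qed
  qed (use R_nonneg in simp)
  have Q_lim: "AE x in lebesgue. (\<lambda>n. Q n x) \<longlonglongrightarrow> 0"
  proof (rule AE_LIMSEQ_zero_of_geometric[OF Q_int Q_nonneg])
    show "(LINT x|lebesgue. Q n x) \<le> 2 * (1/2)^n" for n
      using sum_le[of n] IR[of n] by simp
  qed
  have "AE x in lebesgue. (AE y in lebesgue. (\<lambda>n. R n (x, y)) \<longlonglongrightarrow> 0) \<and> (\<lambda>n. Q n x) \<longlonglongrightarrow> 0
    \<and> (x \<in> \<Omega> \<longrightarrow> 0 < v x)"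
    using leb_pair.AE_pair[OF R_lim] Q_lim vpos by eventually_elim auto
  \<comment> \<open>The base point: here \<open>u n x\<close> tends to zero, and the remainders vanish in the limit against almost every \<open>y\<close>.\<close>
  from not_AE_obtain[OF this gt] obtain x
    where x0: "(AE y in lebesgue. (\<lambda>n. R n (x, y)) \<longlonglongrightarrow> 0) \<and> (\<lambda>n. Q n x) \<longlonglongrightarrow> 0
      \<and> (x \<in> \<Omega> \<longrightarrow> 0 < v x)" "\<not> (x \<in> \<Omega> \<longrightarrow> b x \<le> first_eigenvalue \<Omega>)" .
  have x: "AE y in lebesgue. (\<lambda>n. R n (x, y)) \<longlonglongrightarrow> 0" "(\<lambda>n. Q n x) \<longlonglongrightarrow> 0"
      "x \<in> \<Omega>" "0 < v x" "\<mu> < b x"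
    using x0 unfolding \<mu>_def by simp_all
  have "(\<lambda>n. Q n x / (b x - \<mu>)) \<longlonglongrightarrow> 0 / (b x - \<mu>)"
    using x by (intro tendsto_intros) auto
  then have "(\<lambda>n. (u n x)\<^sup>2) \<longlonglongrightarrow> 0" using x(5) by (simp add: Q_def)
  then have ux: "(\<lambda>n. u n x) \<longlonglongrightarrow> 0"
    by (rule tendsto_zero_of_square)
  have uy: "AE y in lebesgue. (\<lambda>n. u n y) \<longlonglongrightarrow> 0"
    using x(1) vpos
  proof eventually_elim
    case (elim y)
    show ?case
    proof (cases "y \<in> \<Omega> \<and> y \<noteq> x")
      case True
      show ?thesis
      proof (rule tendsto_zero_of_picone_remainder[where u = u and v = v and x = x and y = y and d = d and K = "K (x, y)"])
        show "d \<longlonglongrightarrow> 0" "0 < d n" "0 < v x" for n by (fact d_lim, fact d(1), fact x(4))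
        show "(\<lambda>n. u n x) \<longlonglongrightarrow> 0" by (fact ux)
        show "0 < v y" using elim True by simp
        show "0 < K (x, y)" unfolding K_def using True by (intro kernels_pos) auto
        show "(\<lambda>n. picone_remainder (d n) (u n) v x y * K (x, y)) \<longlonglongrightarrow> 0"
          using elim True x(3) by (simp add: R_def)
      qed
    next
      case False
      then show ?thesis using ux H_spaceD(3)[OF u] by auto
    qed
  qed
  have EL_le: "EL_form (u n) (u n) \<le> \<bar>\<mu>\<bar> + 1" for n
  proof -
    have "\<mu> * (LINT x|lebesgue. (u n x)\<^sup>2) \<le> \<bar>\<mu>\<bar> * 1"
      using lower[of n] upper[of n] by (intro mult_mono) auto
    moreover have "(1/2::real)^n \<le> 1" by (simp add: power_le_one)
    ultimately show ?thesis using EL[of n] by linarith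
  qed
  show False
    using no_vanishing_almost_minimizers[OF \<Omega>' u lower upper EL_le] uy by (rule notE)
qed

text \<open>The factor \<open>s\<close> is the sign of the solution, 1 or -1. By linearity \<open>\<bar>v\<bar>\<close> is again a
  solution; it is nonnegative everywhere, and it solves the equation for a coefficient \<open>b\<close> that is
  bounded everywhere and defined on the whole space.\<close>

lemma no_solution_of_one_sign:
  fixes \<Omega> :: "'a::euclidean_space set" and a v :: "'a \<Rightarrow> real"
  assumes \<Omega>: "open \<Omega>" "bounded \<Omega>"
    and a: "a \<in> Linfty \<Omega>"
    and ge: "AE x in lebesgue_on \<Omega>. first_eigenvalue \<Omega> \<le> a x"
    and gt: "emeasure lebesgue {x \<in> \<Omega>. a x > first_eigenvalue \<Omega>} > 0"
    and v: "weak_solution \<Omega> a v"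
    and nontriv: "\<not> (AE x in lebesgue_on \<Omega>. v x = 0)"
    and sign: "AE x in lebesgue. \<bar>v x\<bar> = s * v x"
  shows False
proof -
  have [measurable]: "\<Omega> \<in> sets lebesgue" using \<Omega> by auto
  obtain C where C: "AE x in lebesgue_on \<Omega>. \<bar>a x\<bar> \<le> C"
    and [measurable]: "a \<in> borel_measurable (lebesgue_on \<Omega>)" using a by (auto simp: Linfty_def)
  have vH: "v \<in> H_space \<Omega>"
    and weak: "\<And>\<phi>. \<phi> \<in> H_space \<Omega> \<Longrightarrow> EL_form v \<phi> = (LINT x|lebesgue_on \<Omega>. a x * v x * \<phi> x)"
    using v by (auto simp: weak_solution_def)
  note [measurable] = H_spaceD(1)[OF vH]
  \<comment> \<open>Clipping changes \<open>a\<close> only on a null set, but it gives a bound at every point.\<close>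
  define b where "b x = (if x \<in> \<Omega> then truncation \<bar>C\<bar> (a x) else 0)" for x
  have "(\<lambda>x. truncation \<bar>C\<bar> (a x)) \<in> borel_measurable (lebesgue_on \<Omega>)"
    unfolding truncation_def by measurable
  then have b: "b \<in> borel_measurable lebesgue"
    unfolding b_def[abs_def] by (rule borel_measurable_if_I) simp
  have ab: "AE x in lebesgue_on \<Omega>. b x = a x"
  proof -
    have "AE x in lebesgue_on \<Omega>. x \<in> \<Omega>" by (rule AE_I2) simp
    with C show ?thesis by eventually_elim (auto simp: b_def truncation_def max_def min_def)
  qed
  have weak': "EL_form v \<phi> = (LINT x|lebesgue. b x * (v x * \<phi> x))" if \<phi>: "\<phi> \<in> H_space \<Omega>" for \<phi>
  proof -
    note [measurable] = H_spaceD(1)[OF \<phi>] b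
    have "EL_form v \<phi> = (LINT x|lebesgue_on \<Omega>. a x * v x * \<phi> x)" by (rule weak[OF \<phi>])
    also have "\<dots> = (LINT x|lebesgue_on \<Omega>. b x * (v x * \<phi> x))"
    proof (rule integral_cong_AE)
      show "(\<lambda>x. a x * v x * \<phi> x) \<in> borel_measurable (lebesgue_on \<Omega>)"
        using H_spaceD(1)[OF \<phi>] H_spaceD(1)[OF vH]
        by (intro borel_measurable_times) (auto intro: measurable_restrict_space1)
      show "(\<lambda>x. b x * (v x * \<phi> x)) \<in> borel_measurable (lebesgue_on \<Omega>)"
        by (rule measurable_restrict_space1) measurable
      show "AE x in lebesgue_on \<Omega>. a x * v x * \<phi> x = b x * (v x * \<phi> x)"
        using ab by eventually_elim simp
    qed
    also have "\<dots> = (LINT x|lebesgue. indicator \<Omega> x *\<^sub>R (b x * (v x * \<phi> x)))"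
      by (intro integral_restrict_space) auto
    also have "\<dots> = (LINT x|lebesgue. b x * (v x * \<phi> x))"
      by (intro Bochner_Integration.integral_cong) (auto simp: b_def indicator_def)
    finally show ?thesis .
  qed
  have sign2: "AE p in leb2. \<bar>v (fst p)\<bar> = s * v (fst p) \<and> \<bar>v (snd p)\<bar> = s * v (snd p)"
    using AE_leb2_coordinates[OF sign] .
  have weak_abs: "EL_form (\<lambda>x. \<bar>v x\<bar>) \<phi> = (LINT x|lebesgue. b x * (\<bar>v x\<bar> * \<phi> x))" if \<phi>: "\<phi> \<in> H_space \<Omega>" for \<phi>
  proof -
    note [measurable] = H_spaceD(1)[OF \<phi>] b
    have e1: "(LINT p|leb2. (\<bar>v (fst p)\<bar> - \<bar>v (snd p)\<bar>) * (\<phi> (fst p) - \<phi> (snd p)) * k_kernel (fst p - snd p))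
      = (LINT p|leb2. s * ((v (fst p) - v (snd p)) * (\<phi> (fst p) - \<phi> (snd p)) * k_kernel (fst p - snd p)))"
      by (rule integral_cong_AE, measurable) (rule eventually_mono[OF sign2], simp add: algebra_simps)
    have e2: "(LINT p|leb2. \<bar>v (fst p)\<bar> * \<phi> (snd p) * j_kernel (fst p - snd p))
      = (LINT p|leb2. s * (v (fst p) * \<phi> (snd p) * j_kernel (fst p - snd p)))"
      by (rule integral_cong_AE, measurable) (rule eventually_mono[OF sign2], simp add: algebra_simps)
    have e3: "(LINT x|lebesgue. \<bar>v x\<bar> * \<phi> x) = (LINT x|lebesgue. s * (v x * \<phi> x))"
      by (rule integral_cong_AE, measurable) (rule eventually_mono[OF sign], simp add: algebra_simps)
    have "EL_form (\<lambda>x. \<bar>v x\<bar>) \<phi> = s * EL_form v \<phi>"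
    proof -
      have "c / 2 * (s * A) - c * (s * B) + r * (s * D) = s * (c / 2 * A - c * B + r * D)" for A B D c r
        by (simp add: algebra_simps)
      then show ?thesis unfolding EL_form_alt e1 e2 e3 integral_mult_right_zero .
    qed
    also have "\<dots> = (LINT x|lebesgue. s * (b x * (v x * \<phi> x)))"
      unfolding weak'[OF \<phi>] by simp
    also have "\<dots> = (LINT x|lebesgue. b x * (\<bar>v x\<bar> * \<phi> x))"
      by (rule integral_cong_AE, measurable) (rule eventually_mono[OF sign], simp add: algebra_simps)
    finally show ?thesis .
  qed
  have "AE x in lebesgue. x \<in> \<Omega> \<longrightarrow> b x \<le> first_eigenvalue \<Omega>"
  proof (rule no_nonnegative_solution[OF \<Omega> H_space_abs[OF vH] _ b _ weak_abs])
    show "\<bar>b x\<bar> \<le> \<bar>C\<bar>" for x using truncation_le(2)[of "\<bar>C\<bar>" "a x"] by (simp add: b_def)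
    show "\<not> (AE x in lebesgue. \<bar>v x\<bar> = 0)"
    proof
      assume "AE x in lebesgue. \<bar>v x\<bar> = 0"
      then have "AE x in lebesgue. x \<in> \<Omega> \<longrightarrow> v x = 0" by (rule eventually_mono) simp
      with nontriv show False by (simp add: AE_restrict_space_iff)
    qed
    have "AE x in lebesgue_on \<Omega>. first_eigenvalue \<Omega> \<le> b x"
      using ge ab by eventually_elim simp
    then show "AE x in lebesgue. x \<in> \<Omega> \<longrightarrow> first_eigenvalue \<Omega> \<le> b x"
      by (simp add: AE_restrict_space_iff)
  qed simp
  moreover have "AE x in lebesgue. x \<in> \<Omega> \<longrightarrow> b x = a x"
    using ab by (simp add: AE_restrict_space_iff)
  ultimately have "AE x in lebesgue. x \<notin> {x \<in> \<Omega>. a x > first_eigenvalue \<Omega>}"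
    by eventually_elim auto
  moreover have "{x \<in> \<Omega>. a x > first_eigenvalue \<Omega>} \<in> sets lebesgue"
  proof (rule ccontr)
    assume "\<not> ?thesis"
    then show False using gt by (simp add: emeasure_notin_sets)
  qed
  ultimately have "{x \<in> \<Omega>. a x > first_eigenvalue \<Omega>} \<in> null_sets lebesgue"
    using AE_iff_null_sets by blast
  then have "emeasure lebesgue {x \<in> \<Omega>. a x > first_eigenvalue \<Omega>} = 0" by (rule null_setsD1)
  with gt show False by (simp only: less_irrefl)
qed

theorem theorem2p2:
  fixes \<Omega> :: "'a::euclidean_space set" and a v :: "'a \<Rightarrow> real"
  assumes "bounded_C11_domain \<Omega>"
    and "a \<in> Linfty \<Omega>"
    and "AE x in lebesgue_on \<Omega>. a x \<ge> first_eigenvalue \<Omega>"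
    and "emeasure lebesgue {x \<in> \<Omega>. a x > first_eigenvalue \<Omega>} > 0"
    and "weak_solution \<Omega> a v"
    and "\<not> (AE x in lebesgue_on \<Omega>. v x = 0)"
  shows "sign_changing \<Omega> v"
proof (rule ccontr)
  assume not: "\<not> sign_changing \<Omega> v"
  have \<Omega>: "open \<Omega>" "bounded \<Omega>" using assms(1) by (auto simp: bounded_C11_domain_def)
  have vH: "v \<in> H_space \<Omega>" using assms(5) by (simp add: weak_solution_def)
  note [measurable] = H_spaceD(1)[OF vH]
  have [measurable]: "\<Omega> \<in> sets lebesgue" using \<Omega> by auto
  have sets: "{x \<in> \<Omega>. v x > 0} \<in> sets lebesgue" "{x \<in> \<Omega>. v x < 0} \<in> sets lebesgue"
    by measurable
  from not have "emeasure lebesgue {x \<in> \<Omega>. v x > 0} = 0 \<or> emeasure lebesgue {x \<in> \<Omega>. v x < 0} = 0"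
    by (simp add: sign_changing_def zero_less_iff_neq_zero)
  then show False
  proof
    assume "emeasure lebesgue {x \<in> \<Omega>. v x > 0} = 0"
    then have "{x \<in> \<Omega>. v x > 0} \<in> null_sets lebesgue" using sets by blast
    from AE_not_in[OF this] have "AE x in lebesgue. \<bar>v x\<bar> = (-1) * v x"
      by (rule eventually_mono) (use H_spaceD(3)[OF vH] in force)
    then show False by (rule no_solution_of_one_sign[OF \<Omega> assms(2-6)])
  next
    assume "emeasure lebesgue {x \<in> \<Omega>. v x < 0} = 0"
    then have "{x \<in> \<Omega>. v x < 0} \<in> null_sets lebesgue" using sets by blast
    from AE_not_in[OF this] have "AE x in lebesgue. \<bar>v x\<bar> = 1 * v x"
      by (rule eventually_mono) (use H_spaceD(3)[OF vH] in force)
    then show False by (rule no_solution_of_one_sign[OF \<Omega> assms(2-6)])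
  qed
qed

end
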